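(* In the secretary problem with values in $[0,1]$, the best-only pricing curve with threshold function $f(t)=\exp(-t/c)$, $c=0.472$, has worst-case regret at most $0.190$.
   Context: Secretary problem: an adversary fixes $n$ values $1\ge x_1\ge\dots\ge x_n\ge 0$; each $x_i$ arrives at an independent uniform time $t_i\in[0,1]$; an online algorithm observes values in increasing arrival time, irrevocably decides whether to pick each, picks at most one, and obtains $0$ if it picks none. The regret is $\sup_{\vec x}(x_1-\mathbb{E}[\mathsf{Alg}(\vec x)])$ over all $n$ and all value vectors. A best-only pricing curve with threshold function $f:[0,1]\to[0,1]$ picks the first arriving value $x_i$ such that both $x_i\ge f(t_i)$ and $x_i$ is the largest value arrived so far (ties are broken by adding arbitrarily small noise so that values are distinct). *)

theory Defs
  imports "HOL-Probability.Probability"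
begin

text \<open>
  Items are numbered \<open>1, \<dots>, n\<close> as in \<open>1 \<ge> x\<^sub>1 \<ge> \<dots> \<ge> x\<^sub>n \<ge> 0\<close>; value and arrival-time vectors are
  functions on \<^typ>\<open>nat\<close> of which only the entries in \<^term>\<open>{1..n}\<close> matter.
\<close>

definition instances :: "(nat \<times> (nat \<Rightarrow> real)) set" where
  "instances = {(n, x). 1 \<le> n \<and> (\<forall>i\<in>{1..n}. 0 \<le> x i \<and> x i \<le> 1) \<and>
                        (\<forall>i\<in>{1..n}. \<forall>j\<in>{1..n}. i \<le> j \<longrightarrow> x j \<le> x i)}"

definition arrival_times :: "nat \<Rightarrow> (nat \<Rightarrow> real) measure" where
  "arrival_times n = (\<Pi>\<^sub>M i\<in>{1..n}. uniform_measure lborel {0..1})"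

text \<open>
  A selection rule maps the number of items, the values and the arrival times to the picked item,
  if any. It is not restricted to online rules here.
\<close>

type_synonym selection_rule = "nat \<Rightarrow> (nat \<Rightarrow> real) \<Rightarrow> (nat \<Rightarrow> real) \<Rightarrow> nat option"

definition payoff :: "(nat \<Rightarrow> real) \<Rightarrow> nat option \<Rightarrow> real" where
  "payoff x p = (case p of None \<Rightarrow> 0 | Some i \<Rightarrow> x i)"

text \<open>
  The supremum is taken in \<^typ>\<open>ereal\<close> so that it needs no boundedness side condition. A
  non-measurable payoff would have expectation \<open>0\<close> and hence only increase the regret.
\<close>

definition regret :: "selection_rule \<Rightarrow> ereal" where
  "regret A = (SUP (n, x)\<in>instances.
     ereal (x 1 - (\<integral>t. payoff x (A n x t) \<partial>arrival_times n)))"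

text \<open>
  Ties are broken by noise: \<open>x i\<close> is perturbed to \<open>x i + \<epsilon> * \<eta> i\<close> for all sufficiently small
  \<open>\<epsilon> > 0\<close>. For injective \<open>\<eta>\<close> this makes the values distinct and never reverses a strict
  inequality between them. Thresholds and payoffs use the unperturbed values, which is the limit
  \<open>\<epsilon> \<rightarrow> 0\<close>.
\<close>

definition beats :: "(nat \<Rightarrow> real) \<Rightarrow> (nat \<Rightarrow> real) \<Rightarrow> nat \<Rightarrow> nat \<Rightarrow> bool" where
  "beats \<eta> x i j \<longleftrightarrow> (\<forall>\<^sub>F \<epsilon> in at_right 0. x j + \<epsilon> * \<eta> j < x i + \<epsilon> * \<eta> i)"

text \<open>
  The first arrival among the acceptable items is the one with the least arrival time;
  coinciding arrival times, which have probability \<open>0\<close>, are resolved arbitrarily.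
\<close>

definition acceptable ::
    "(nat \<Rightarrow> real) \<Rightarrow> (real \<Rightarrow> real) \<Rightarrow> nat \<Rightarrow> (nat \<Rightarrow> real) \<Rightarrow> (nat \<Rightarrow> real) \<Rightarrow> nat set" where
  "acceptable \<eta> f n x t =
     {i\<in>{1..n}. f (t i) \<le> x i \<and> (\<forall>j\<in>{1..n}. t j < t i \<longrightarrow> beats \<eta> x i j)}"

definition best_only_pricing_curve ::
    "(nat \<Rightarrow> real) \<Rightarrow> (real \<Rightarrow> real) \<Rightarrow> selection_rule" where
  "best_only_pricing_curve \<eta> f n x t =
     (if acceptable \<eta> f n x t = {} then None
      else Some (arg_min_on t (acceptable \<eta> f n x t)))"

end

theory Submission
  imports Defs
begin

text \<open>
  Rank the items by value, let \<open>y\<^sub>1 \<ge> \<dots> \<ge> y\<^sub>n\<close> be the values and \<open>A\<^sub>j\<close> the average of \<open>y\<^sub>1, \<dots>, y\<^sub>j\<close>.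
  Adding the items in order of rank changes the picked value only when item \<open>j\<close> arrives before the
  items \<open>1, \<dots>, j - 1\<close> and at a time that its threshold allows; it then replaces the first
  arrival among those items. By exchangeability of the arrival times the expected payoff is
  \<open>\<Sum>\<^sub>j w\<^sub>j\<^sup>j (A\<^sub>j - A\<^sub>j\<^sub>-\<^sub>1)\<close>, where \<open>w\<^sub>j = max 0 (1 + c ln y\<^sub>j)\<close> is the probability that a time is
  allowed at value \<open>y\<^sub>j\<close>. The regret is therefore
  \<open>y\<^sub>1 (1 - w\<^sub>1) + \<Sum>\<^sub>j\<^sub>\<ge>\<^sub>2 w\<^sub>j\<^sup>j (A\<^sub>j\<^sub>-\<^sub>1 - A\<^sub>j)\<close>.
  Replacing \<open>ln\<close> by a tangent makes \<open>w\<^sub>j\<close> affine in \<open>y\<^sub>j\<close>; in affine coordinates the sum over \<open>j \<ge> 2\<close>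
  has a bound that does not depend on the tangent, by a supersolution of its dynamic
  program. It remains to choose tangents suitable for each \<open>y\<^sub>1 \<in> [0, 1]\<close>.
\<close>

section \<open>The dynamic program for the weighted decrements\<close>

text \<open>The long factor is the negative binomial series of \<open>1 / (1 - u) ^ j\<close>, cut
  after its cubic term. Multiplying the truncation for \<open>j + 1\<close> by \<open>1 - u\<close>
  gives the truncation for \<open>j\<close> minus a nonnegative remainder.\<close>

lemma one_minus_power_negative_binomial:
  fixes u :: real
  assumes "0 \<le> u" "u \<le> 1"
  shows "(1 - u) ^ j * (1 + j * u + j * (real j + 1) / 2 * u\<^sup>2 + j * (real j + 1) * (real j + 2) / 6 * u ^ 3) \<le> 1"
proof (induction j)
  case (Suc j)
  let ?E = "\<lambda>j::real. 1 + j * u + j * (j + 1) / 2 * u\<^sup>2 + j * (j + 1) * (j + 2) / 6 * u ^ 3"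
  let ?r = "(real j + 1) * (real j + 2) * (real j + 3) / 6 * u ^ 4"
  have "(1 - u) * ?E (real j + 1) = ?E j - ?r"
    by (simp add: field_simps power2_eq_square power3_eq_cube power4_eq_xxxx)
  also have "\<dots> \<le> ?E j"
    using assms by simp
  finally have "(1 - u) ^ j * ((1 - u) * ?E (real j + 1)) \<le> (1 - u) ^ j * ?E j"
    using assms by (intro mult_left_mono) auto
  with Suc.IH show ?case
    by (simp add: algebra_simps)
qed simp

lemma one_minus_power_le_quadratic:
  fixes a :: real
  assumes "0 \<le> a" "a \<le> 1"
  shows "(1 - a) ^ n \<le> 1 - n * a + n * (real n - 1) / 2 * a\<^sup>2"
proof (induction n)
  case (Suc n)
  have "(1 - a) ^ Suc n \<le> (1 - a) * (1 - n * a + n * (real n - 1) / 2 * a\<^sup>2)"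
    using Suc assms by (simp add: mult_left_mono)
  also have "\<dots> = 1 - Suc n * a + Suc n * (real (Suc n) - 1) / 2 * a\<^sup>2 - n * (real n - 1) / 2 * a ^ 3"
    by (simp add: field_simps power2_eq_square power3_eq_cube)
  also have "\<dots> \<le> 1 - Suc n * a + Suc n * (real (Suc n) - 1) / 2 * a\<^sup>2"
    using assms by (cases n) auto
  finally show ?case .
qed simp

text \<open>These are the terms up to degree 3 that remain when the product in
  \<open>tail_step_quintic\<close> is expanded; \<open>22/9\<close> is \<open>40/9 - 2\<close>. The
  quadratic and cubic coefficients dominate affine functions of \<open>e\<close>, so interpolation
  between \<open>e = 0\<close> and \<open>e = 1/4\<close> suffices.\<close>

lemma cubic_lower_bound:
  fixes e y :: real
  assumes "0 \<le> e" "e \<le> 1/4" "0 \<le> y"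
  shows "0 \<le> 1 - 22/9 * (1 + e) * y + ((1 + e) / 2 + (1 + 2 * e) - e * (1 + e) * (1 + 2 * e) / 2) * y\<^sup>2
          + (1 + e) * (1 + 2 * e) * (2/3 - e / 2) * y ^ 3"
proof -
  have c0: "0 \<le> 1 - 22/9 * y + 3/2 * y\<^sup>2 + 2/3 * y ^ 3" (is "0 \<le> ?c0")
  proof -
    \<comment> \<open>Expansion about \<open>3/5\<close>, close to the minimizer over
      \<open>y \<ge> 0\<close>: what remains besides the squares is the tangent line there, with
      nonnegative coefficients.\<close>
    have "?c0 = 2/3 * ((y - 3/5)\<^sup>2 * (y + 6/5)) + 3/2 * (y - 3/5)\<^sup>2 + (17/225 * y + 43/250)"
      by (simp add: field_simps power2_eq_square power3_eq_cube)
    then show ?thesis using assms by simp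
  qed
  have c1: "0 \<le> 1 - 55/18 * y + 189/100 * y\<^sup>2 + (2/3 + 139/400) * y ^ 3" (is "0 \<le> ?c1")
  proof -
    have "?c1 = 1217/1200 * ((y - 57/100)\<^sup>2 * (y + 57/50)) + 189/100 * (y - 57/100)\<^sup>2
            + (3151897/36000000 * y + 2061173/200000000)"
      by (simp add: field_simps power2_eq_square power3_eq_cube)
    then show ?thesis using assms by simp
  qed
  have e2: "0 \<le> e * (1/4 - e)" using assms by simp
  have e3: "0 \<le> e\<^sup>2 * (1/4 - e)" using assms by simp
  have q2: "3/2 + 156/100 * e \<le> (1 + e) / 2 + (1 + 2 * e) - e * (1 + e) * (1 + 2 * e) / 2"
    using e2 e3 assms by (simp add: field_simps power2_eq_square)
  have q3: "2/3 + 139/100 * e \<le> (1 + e) * (1 + 2 * e) * (2/3 - e / 2)"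
    using e2 e3 assms by (simp add: field_simps power2_eq_square)
  have "0 \<le> (1 - 4 * e) * ?c0 + 4 * e * ?c1"
    using c0 c1 assms by simp
  also have "\<dots> = 1 - 22/9 * (1 + e) * y + (3/2 + 156/100 * e) * y\<^sup>2 + (2/3 + 139/100 * e) * y ^ 3"
    by (simp add: field_simps)
  also have "\<dots> \<le> 1 - 22/9 * (1 + e) * y + ((1 + e) / 2 + (1 + 2 * e) - e * (1 + e) * (1 + 2 * e) / 2) * y\<^sup>2
      + ((1 + e) * (1 + 2 * e) * (2/3 - e / 2)) * y ^ 3"
    using q2 q3 assms by (intro add_mono mult_right_mono) auto
  finally show ?thesis .
qed

text \<open>With \<open>e = 1 / j\<close> and \<open>y = j * u\<close> this is the step inequality for \<open>(9/40) B\<^sup>j\<^sup>+\<^sup>1 / j\<close> at \<open>z = (1 - u) B\<close>, \<open>B = 1\<close>.\<close>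
lemma tail_step_quintic:
  fixes e y :: real
  assumes "0 \<le> e" "e \<le> 1/4" "0 \<le> y" "e * y \<le> 1"
  shows "(1 + e) * y \<le> 9/40 * (1 + (1 + 2 * e) * y - e * (1 + e) * (1 + 2 * e) * y\<^sup>2 / 2)
           * (1 + y + (1 + e) * y\<^sup>2 / 2 + (1 + e) * (1 + 2 * e) * y ^ 3 / 6)"
proof -
  define k where "k = (1 + e) * (1 + 2 * e)"
  have k: "0 \<le> k" "e * (1 + e) \<le> 5/16"
  proof -
    show "0 \<le> k" unfolding k_def using assms by simp
    have "e * (1 + e) \<le> 1/4 * (5/4)" using assms by (intro mult_mono) auto
    then show "e * (1 + e) \<le> 5/16" by simp
  qed
  have nn: "0 \<le> (1 + 2 * e) / 6 - e * (1 + e) / 4 - e * y * k / 12"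
  proof -
    have "k \<le> 5/4 * (3/2)" unfolding k_def using assms by (intro mult_mono) auto
    moreover have "e * y * k \<le> 1 * k" using assms k by (intro mult_right_mono) auto
    moreover have "k = 1 + 3 * e + 2 * e * e" "e * (1 + e) = e + e * e"
      by (simp_all add: k_def algebra_simps)
    moreover have "e * e \<le> 1/4 * e"
      using assms by (intro mult_right_mono) auto
    ultimately show ?thesis using assms by (simp add: field_simps)
  qed
  have "0 \<le> k * y ^ 4 * ((1 + 2 * e) / 6 - e * (1 + e) / 4 - e * y * k / 12)"
    using nn k assms by simp
  moreover have "(1 + (1 + 2 * e) * y - e * k * y\<^sup>2 / 2) * (1 + y + (1 + e) * y\<^sup>2 / 2 + k * y ^ 3 / 6) - 40/9 * ((1 + e) * y)
    = (1 - 22/9 * (1 + e) * y + ((1 + e) / 2 + (1 + 2 * e) - e * k / 2) * y\<^sup>2 + k * (2/3 - e / 2) * y ^ 3)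
      + k * y ^ 4 * ((1 + 2 * e) / 6 - e * (1 + e) / 4 - e * y * k / 12)" (is "?L = _")
    unfolding k_def by (simp add: field_simps power2_eq_square power3_eq_cube power4_eq_xxxx)
  ultimately have "0 \<le> ?L"
    using cubic_lower_bound[OF assms(1-3)] unfolding k_def by (simp add: mult_ac)
  then have "(1 + e) * y \<le> 9/40 * ((1 + (1 + 2 * e) * y - e * k * y\<^sup>2 / 2) * (1 + y + (1 + e) * y\<^sup>2 / 2 + k * y ^ 3 / 6))"
    by (subst (asm) le_diff_eq) (simp add: mult_ac)
  then show ?thesis
    unfolding k_def by (simp only: mult.assoc)
qed

text \<open>The first power is at most \<open>1 / E\<close>, and the second is bounded by its
  quadratic truncation, expressed through \<open>K\<close>. Clearing denominators leaves
  \<open>(j + 1) * u \<le> 9/40 * K * E\<close>, which is \<open>tail_step_quintic\<close> for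
  \<open>e = 1 / j\<close> and \<open>y = j * u\<close>.\<close>

lemma tail_step_unit:
  fixes u :: real
  assumes "0 \<le> u" "u \<le> 1" "j \<ge> 4"
  shows "(1 - u) ^ j * u / j + 9/40 / (real j + 1) * (1 - u / j) ^ (j + 2) \<le> 9/40 / j"
proof -
  define e where "e = 1 / real j"
  define y where "y = real j * u"
  define E where "E = 1 + j * u + j * (real j + 1) / 2 * u\<^sup>2 + j * (real j + 1) * (real j + 2) / 6 * u ^ 3"
  define K where "K = 1 + (real j + 2) * u - (real j + 1) * (real j + 2) * u\<^sup>2 / (2 * j)"
  have j: "real j \<ge> 4" using assms by simp
  have "E \<ge> 1" unfolding E_def using assms by simp
  have "(1 - u) ^ j * E \<le> 1"
    unfolding E_def by (rule one_minus_power_negative_binomial) fact+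
  have "(1 + e) * y \<le> 9/40 * K * E"
  proof -
    have "e * y \<le> 1" "e \<le> 1/4" "0 \<le> e" "0 \<le> y"
      using assms j by (auto simp: e_def y_def field_simps)
    note tail_step_quintic[OF this(3,2,4,1)]
    moreover have "(1 + 2 * e) * y = (real j + 2) * u" "e * y = u" "(1 + e) * y = (real j + 1) * u"
      using j by (simp_all add: e_def y_def field_simps)
    moreover have "e * (1 + e) * (1 + 2 * e) * y\<^sup>2 / 2 = ((1 + e) * y) * ((1 + 2 * e) * y) * e / 2"
      "(1 + e) * y\<^sup>2 / 2 = ((1 + e) * y) * y / 2"
      "(1 + e) * (1 + 2 * e) * y ^ 3 / 6 = ((1 + e) * y) * ((1 + 2 * e) * y) * y / 6"
      by (simp_all add: power2_eq_square power3_eq_cube)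
    moreover have "((real j + 1) * u) * ((real j + 2) * u) * e / 2 = (real j + 1) * (real j + 2) * u\<^sup>2 / (2 * j)"
      by (simp add: e_def power2_eq_square mult_ac add_ac)
    moreover have "(real j + 1) * u * y / 2 = j * (real j + 1) / 2 * u\<^sup>2"
      "(real j + 1) * u * ((real j + 2) * u) * y / 6 = j * (real j + 1) * (real j + 2) / 6 * u ^ 3"
      by (simp_all add: y_def power2_eq_square power3_eq_cube)
    ultimately show ?thesis
      unfolding K_def E_def y_def[symmetric] by (simp only:)
  qed
  moreover have "(1 + e) * y = (j + 1) * u" using j by (simp add: e_def y_def field_simps)
  ultimately have "(j + 1) * u \<le> 9/40 * K * E" by simp
  then have "(1 - u) ^ j * ((j + 1) * u) \<le> (1 - u) ^ j * (9/40 * K * E)"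
    using assms by (intro mult_left_mono) auto
  also have "\<dots> = 9/40 * K * ((1 - u) ^ j * E)" by simp
  also have "\<dots> \<le> 9/40 * K * 1"
  proof (intro mult_left_mono \<open>(1 - u) ^ j * E \<le> 1\<close>)
    \<comment> \<open>\<open>K\<close> has a negative term; its sign is read off from the inequality
      just obtained.\<close>
    have "0 \<le> (j + 1) * u" using assms by simp
    with \<open>(j + 1) * u \<le> 9/40 * K * E\<close> \<open>E \<ge> 1\<close> show "0 \<le> 9/40 * K"
      by (smt (verit) mult_neg_pos)
  qed
  finally have 1: "(1 - u) ^ j * ((j + 1) * u) \<le> 9/40 * K" by simp
  have "(1 - u / j) ^ (j + 2) \<le> 1 - (j + 2) * (u / j) + (j + 2) * (real (j + 2) - 1) / 2 * (u / j)\<^sup>2"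
    using one_minus_power_le_quadratic[of "u / j" "j + 2"] assms j by simp
  also have "\<dots> = (real j + 1) / j - K / j"
    using j by (simp add: K_def field_simps power2_eq_square)
  finally have 2: "(1 - u / j) ^ (j + 2) \<le> (real j + 1) / j - K / j" .
  have "(1 - u) ^ j * u / j = (1 - u) ^ j * ((j + 1) * u) / (j * (real j + 1))"
    using j by (simp add: divide_simps)
  also have "\<dots> \<le> 9/40 * K / (j * (real j + 1))"
    using 1 by (intro divide_right_mono) auto
  finally have "(1 - u) ^ j * u / j \<le> 9/40 * K / (j * (real j + 1))" .
  moreover have "9/40 / (real j + 1) * (1 - u / j) ^ (j + 2) \<le> 9/40 / (real j + 1) * ((real j + 1) / j - K / j)"
    using 2 by (intro mult_left_mono) auto
  moreover have "9/40 / (real j + 1) * ((real j + 1) / j - K / j) = 9/40 / j - 9/40 * K / (j * (real j + 1))"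
  proof -
    have "9/40 / a * (a / x - K / x) = 9/40 / x - 9/40 * K / (x * a)" if "a > 0" "x > 0" for a x :: real
      using that by (simp add: field_simps)
    then show ?thesis by (rule) (use j in auto)
  qed
  ultimately show ?thesis by linarith
qed

text \<open>
  For large \<open>j\<close>, \<open>C B\<^sup>j\<^sup>+\<^sup>1 / j\<close> is a supersolution as soon as \<open>C\<close> exceeds the maximum of
  \<open>\<rho> exp (- \<rho>) / (1 + \<rho>)\<close> over \<open>\<rho> \<ge> 0\<close>, about \<open>0.206\<close>, where \<open>z = (1 - \<rho> / j) B\<close>;
  the value \<open>9/40\<close> works from \<open>j = 4\<close> on. The sharper dependence on \<open>B\<close> at \<open>j = 3\<close> is
  needed for the constant \<open>0.190\<close>.
\<close>
definition potential :: "nat \<Rightarrow> real \<Rightarrow> real" where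
  "potential j B = (if j = 3 then B ^ 4 * (352/10000 + 398/10000 * B) else 9/40 / j * B ^ (j + 1))"

text \<open>
  Tangents suitable for \<open>y\<^sub>1\<close> near \<open>1\<close> exceed \<open>1\<close> there; as \<open>w \<le> 1\<close>, the slope \<open>1\<close> is enough for \<open>B > 1\<close>.
\<close>
definition potential_ext :: "nat \<Rightarrow> real \<Rightarrow> real" where
  "potential_ext j B = (if B \<le> 1 then potential j B else potential j 1 + (B - 1))"

section \<open>The supersolution from rank 3 on\<close>

lemma potential_nonneg: "0 \<le> B \<Longrightarrow> 0 \<le> potential j B"
  by (simp add: potential_def)

text \<open>The maximum over \<open>r\<close> is \<open>9/256\<close>, at \<open>r = 3/4\<close>;
  rounded up, it is the constant coefficient in \<open>potential 3\<close>.\<close>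

lemma step3_cubic:
  fixes r :: real
  shows "r ^ 3 * (1 - r) / 3 \<le> 352/10000"
proof -
  have "352/10000 - r ^ 3 * (1 - r) / 3 = (r - 3/4)\<^sup>2 * ((r + 1/4)\<^sup>2 + 1/8) / 3 + (352/10000 - 9/256)"
    by (simp add: field_simps power2_eq_square power3_eq_cube)
  also have "\<dots> \<ge> 0" by (intro add_nonneg_nonneg divide_nonneg_nonneg mult_nonneg_nonneg) auto
  finally show ?thesis by simp
qed

text \<open>The step at \<open>j = 3\<close> from \<open>B = 1\<close>: \<open>9/160\<close> is
  \<open>9/40 / 4\<close>, and \<open>75/1000\<close> is \<open>potential 3 1\<close>.\<close>

lemma step3_quintic:
  fixes r :: real
  assumes "0 \<le> r" "r \<le> 1"
  shows "r ^ 3 * (1 - r) / 3 + 9/160 * ((2 + r) / 3) ^ 5 \<le> 75/1000"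
proof -
  \<comment> \<open>Expansion about \<open>83/100\<close>, close to the maximizer; the last summand
    is the tangent line of the difference there, positive on \<open>[0, 1]\<close>.\<close>
  have "75/1000 - (r ^ 3 * (1 - r) / 3 + 9/160 * ((2 + r) / 3) ^ 5) =
     (r - 83/100)\<^sup>2 * (104073463/1080000000 + 8917333/43200000 * r + 71417/216000 * r\<^sup>2 - 1/4320 * r ^ 3)
     + (4345971131/3600000000000 - 65345521/86400000000 * r)"
    by (simp add: field_simps eval_nat_numeral)
  also have "\<dots> \<ge> 0"
  proof -
    have "r ^ 3 \<le> 1" using assms by (simp add: power_le_one)
    then have "0 \<le> 104073463/1080000000 + 8917333/43200000 * r + 71417/216000 * r\<^sup>2 - 1/4320 * r ^ 3"
      using assms zero_le_power2[of r] by linarith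
    then show ?thesis
      using assms by (intro add_nonneg_nonneg mult_nonneg_nonneg) auto
  qed
  finally show ?thesis by simp
qed

text \<open>Scaling \<open>z = r * B\<close> pulls out \<open>B ^ (j + 1)\<close>, and the next
  potential keeps one further factor \<open>B\<close>. From \<open>j = 4\<close> on,
  \<open>B = 1\<close> is therefore the worst case; at \<open>j = 3\<close> the remaining expression
  is affine in \<open>B\<close> and is interpolated between \<open>B = 0\<close> and
  \<open>B = 1\<close>.\<close>

lemma potential_step_homogeneous:
  assumes "3 \<le> j" "0 \<le> r" "r \<le> 1" "0 \<le> B" "B \<le> 1"
  shows "(r * B) ^ j * (B - r * B) / j + potential (Suc j) (B - (B - r * B) / j) \<le> potential j B"
proof -
  define t where "t = 1 - (1 - r) / j"
  have fac: "B - (B - r * B) / j = B * t"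
    by (simp add: t_def algebra_simps diff_divide_distrib)
  have x: "0 \<le> t" using assms by (simp add: t_def)
  have nj: "Suc j \<noteq> 3" using assms by simp
  have "(r * B) ^ j * (B - r * B) / j + potential (Suc j) (B - (B - r * B) / j)
     = B ^ (j + 1) * (r ^ j * (1 - r) / j + B * (9/40 / (real j + 1) * t ^ (j + 2)))"
    unfolding fac potential_def if_not_P[OF nj]
    by (simp add: field_simps power_mult_distrib)
  also have "\<dots> \<le> potential j B"
  proof (cases "j = 3")
    case False
    have "B * (9/40 / (real j + 1) * t ^ (j + 2)) \<le> 1 * (9/40 / (real j + 1) * t ^ (j + 2))"
      using assms x by (intro mult_right_mono) auto
    with tail_step_unit[of "1 - r" j, folded t_def] assms False
    have "r ^ j * (1 - r) / j + B * (9/40 / (real j + 1) * t ^ (j + 2)) \<le> 9/40 / j"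
      by simp
    then show ?thesis
      using False assms by (simp only: potential_def if_False mult.commute[of _ "B ^ (j + 1)"]) (intro mult_left_mono, auto)
  next
    case True
    have "t = (2 + r) / 3" using True by (simp add: t_def field_simps)
    then have "r ^ j * (1 - r) / j + B * (9/40 / (real j + 1) * t ^ (j + 2))
      = (1 - B) * (r ^ 3 * (1 - r) / 3) + B * (r ^ 3 * (1 - r) / 3 + 9/160 * ((2 + r) / 3) ^ 5)"
      by (simp only: True) (simp add: field_simps)
    also have "\<dots> \<le> (1 - B) * (352/10000) + B * (75/1000)"
      using step3_cubic[of r] step3_quintic[of r] assms by (intro add_mono mult_left_mono) auto
    also have "\<dots> = 352/10000 + 398/10000 * B" by (simp add: field_simps)
    finally show ?thesis
      using True assms by (simp add: potential_def mult_left_mono)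
  qed
  finally show ?thesis .
qed

text \<open>The Bellman inequality. In state \<open>B\<close>, the average of \<open>j - 1\<close>
  values, the choice \<open>z\<close> earns \<open>z ^ j * (B - z) / j\<close> and moves the state
  to the average that includes \<open>z\<close>.\<close>

lemma potential_step:
  assumes "3 \<le> j" "0 \<le> z" "z \<le> B" "B \<le> 1"
  shows "z ^ j * (B - z) / j + potential (Suc j) (B - (B - z) / j) \<le> potential j B"
proof (cases "B = 0")
  case True
  with assms show ?thesis by (simp add: potential_def)
next
  case False
  with assms have "0 < B" by simp
  with potential_step_homogeneous[of j "z / B" B] assms show ?thesis
    by simp
qed

text \<open>\<open>z\<close> is the affine majorant of the probability \<open>w\<close>, so
  \<open>z\<close> may exceed \<open>1\<close> while \<open>w\<close> may not. The part of a
  decrement above \<open>1\<close> is charged at slope \<open>1\<close>; the part below is a step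
  from state \<open>1\<close>.\<close>

lemma potential_ext_step:
  assumes "3 \<le> j" "0 \<le> w" "w \<le> 1" "w \<le> z" "z \<le> B"
  shows "w ^ j * (B - z) / j + potential_ext (Suc j) (B - (B - z) / j) \<le> potential_ext j B"
proof -
  define B' where "B' = B - (B - z) / j"
  have B': "B' \<le> B" "(B - z) / j = B - B'" using assms by (auto simp: B'_def)
  \<comment> \<open>The choice \<open>z = 1\<close> in state \<open>1\<close> leaves the state
    unchanged and earns nothing.\<close>
  have one: "potential (Suc j) 1 \<le> potential j 1"
    using potential_step[of j 1 1] assms by simp
  show ?thesis
  proof (cases "B \<le> 1")
    case True
    have "w ^ j * (B - z) / j \<le> z ^ j * (B - z) / j"
      using assms by (intro divide_right_mono mult_right_mono power_mono) auto
    with potential_step[of j z B] assms True B' show ?thesis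
      by (simp add: potential_ext_def B'_def[symmetric])
  next
    case B: False
    have wB: "w ^ j * (B - z) / j = w ^ j * (B - B')"
      using B' by (metis times_divide_eq_right)
    have "w ^ j \<le> 1" using assms by (simp add: power_le_one)
    show ?thesis
    proof (cases "B' \<le> 1")
      case True
      \<comment> \<open>\<open>z'\<close> is the choice that leads from state \<open>1\<close> to
        the same \<open>B'\<close>; it exceeds \<open>z\<close> by
        \<open>(j - 1) * (B - 1)\<close>.\<close>
      define z' where "z' = 1 - j * (1 - B')"
      have z': "z \<le> z'" "z' \<le> 1" "(1 - z') / j = 1 - B'"
      proof -
        have "z = B - j * (B - B')" using B'(2) assms by (simp add: field_simps)
        also have "\<dots> = z' - (real j - 1) * (B - 1)" by (simp add: z'_def algebra_simps)
        also have "\<dots> \<le> z'" using assms B by simp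
        finally show "z \<le> z'" .
        show "z' \<le> 1" using True by (simp add: z'_def)
        show "(1 - z') / j = 1 - B'" using assms by (simp add: z'_def)
      qed
      have "w ^ j * (B - B') = w ^ j * (B - 1) + w ^ j * (1 - B')"
        by (simp add: algebra_simps)
      also have "\<dots> \<le> 1 * (B - 1) + z' ^ j * (1 - B')"
        using B True z' assms \<open>w ^ j \<le> 1\<close> by (intro add_mono mult_right_mono power_mono) auto
      finally have "w ^ j * (B - B') \<le> (B - 1) + z' ^ j * (1 - z') / j"
        using z'(3) by (metis mult_1 times_divide_eq_right)
      moreover have "z' ^ j * (1 - z') / j + potential (Suc j) B' \<le> potential j 1"
        using potential_step[of j z' 1] z' assms by simp
      ultimately show ?thesis
        using B True wB by (simp add: potential_ext_def B'_def[symmetric])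
    next
      case False
      have "w ^ j * (B - B') \<le> 1 * (B - B')"
        using B' \<open>w ^ j \<le> 1\<close> by (intro mult_right_mono) auto
      then show ?thesis
        using B False one wB by (simp add: potential_ext_def B'_def[symmetric])
    qed
  qed
qed

text \<open>The Bellman inequalities are summed by induction on \<open>m\<close> downward from the
  empty sum at \<open>Suc n\<close>, where nonnegativity of the potential is enough.\<close>

lemma potential_ext_sum:
  fixes B w z :: "nat \<Rightarrow> real"
  assumes rec: "\<And>j. \<lbrakk>3 \<le> j; j \<le> n\<rbrakk> \<Longrightarrow> B j = B (j - 1) - (B (j - 1) - z j) / j"
    and w: "\<And>j. \<lbrakk>3 \<le> j; j \<le> n\<rbrakk> \<Longrightarrow> 0 \<le> w j \<and> w j \<le> 1 \<and> w j \<le> z j \<and> z j \<le> B (j - 1)"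
    and B: "0 \<le> B n"
    and "3 \<le> m" "m \<le> Suc n"
  shows "(\<Sum>j=m..n. w j ^ j * (B (j - 1) - B j)) \<le> potential_ext m (B (m - 1))"
  using \<open>m \<le> Suc n\<close> \<open>3 \<le> m\<close>
proof (induction m rule: inc_induct)
  case base
  then show ?case using B by (simp add: potential_ext_def potential_nonneg)
next
  case (step m)
  then have m: "3 \<le> m" "m \<le> n" by auto
  have "(\<Sum>j=m..n. w j ^ j * (B (j - 1) - B j)) = w m ^ m * (B (m - 1) - B m) + (\<Sum>j=Suc m..n. w j ^ j * (B (j - 1) - B j))"
    using m by (simp add: sum.atLeast_Suc_atMost)
  also have "\<dots> \<le> w m ^ m * (B (m - 1) - B m) + potential_ext (Suc m) (B m)"
    using step by simp
  also have "\<dots> = w m ^ m * (B (m - 1) - z m) / m + potential_ext (Suc m) (B (m - 1) - (B (m - 1) - z m) / m)"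
    using rec[OF m] by simp
  also have "\<dots> \<le> potential_ext m (B (m - 1))"
    using w[OF m] m by (intro potential_ext_step) auto
  finally show ?case .
qed

section \<open>The step at rank 2 and the bound for the whole sum\<close>

lemma first_step_min:
  fixes r :: real
  assumes "0 \<le> r" "r \<le> 1"
  shows "r\<^sup>2 * (1 - r) / 2 + 3/5 * (352/10000 * ((1 + r) / 2) ^ 4 + 398/10000 * (3/5) * ((1 + r) / 2) ^ 5)
           \<le> 60/1000 + 525/10000 * (3/5)"
proof -
  \<comment> \<open>As at rank 3, the expansion is about a point close to the maximizer, and the
    last summand is the tangent line of the difference there.\<close>
  have "60/1000 + 525/10000 * (3/5) - (r\<^sup>2 * (1 - r) / 2 + 3/5 * (352/10000 * ((1 + r) / 2) ^ 4 + 398/10000 * (3/5) * ((1 + r) / 2) ^ 5))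
     = (r - 71/100)\<^sup>2 * (88861966887/500000000000 + 19380477707/40000000000 * r - 838911/200000000 * r\<^sup>2 - 1791/4000000 * r ^ 3)
     + (708074922633/5000000000000000 + 48541252529/80000000000000 * r)"
    by (simp add: field_simps eval_nat_numeral)
  also have "\<dots> \<ge> 0"
  proof -
    have "r\<^sup>2 \<le> 1" "r ^ 3 \<le> 1" using assms by (simp_all add: power_le_one)
    then have "0 \<le> 88861966887/500000000000 + 19380477707/40000000000 * r - 838911/200000000 * r\<^sup>2 - 1791/4000000 * r ^ 3"
      using assms by linarith
    then show ?thesis
      using assms by (intro add_nonneg_nonneg mult_nonneg_nonneg) auto
  qed
  finally show ?thesis by simp
qed

lemma first_step_max:
  fixes r :: real
  assumes "0 \<le> r" "r \<le> 1"
  shows "r\<^sup>2 * (1 - r) / 2 + 21/20 * (352/10000 * ((1 + r) / 2) ^ 4 + 398/10000 * (21/20) * ((1 + r) / 2) ^ 5)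
           \<le> 60/1000 + 525/10000 * (21/20)"
proof -
  have "60/1000 + 525/10000 * (21/20) - (r\<^sup>2 * (1 - r) / 2 + 21/20 * (352/10000 * ((1 + r) / 2) ^ 4 + 398/10000 * (21/20) * ((1 + r) / 2) ^ 5))
     = (r - 96/125)\<^sup>2 * (11654311142377/62500000000000 + 230271027709/500000000000 * r - 90179103/8000000000 * r\<^sup>2 - 87759/64000000 * r ^ 3)
     + (2851341760035261/1953125000000000000 - 4120557921279/3125000000000000 * r)"
    by (simp add: field_simps eval_nat_numeral)
  also have "\<dots> \<ge> 0"
  proof -
    have "r\<^sup>2 \<le> 1" "r ^ 3 \<le> 1" using assms by (simp_all add: power_le_one)
    then have "0 \<le> 11654311142377/62500000000000 + 230271027709/500000000000 * r - 90179103/8000000000 * r\<^sup>2 - 87759/64000000 * r ^ 3"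
      using assms by linarith
    then show ?thesis
      using assms by (intro add_nonneg_nonneg mult_nonneg_nonneg) auto
  qed
  finally show ?thesis by simp
qed

text \<open>
  The factor of \<open>B\<^sup>3\<close> is an affine majorant, for \<open>3/5 \<le> B \<le> 21/20\<close>, of the optimum over the step \<open>j = 2\<close>.
\<close>
definition start_potential :: "real \<Rightarrow> real" where
  "start_potential B = B ^ 3 * (60/1000 + 525/10000 * B)"

text \<open>In \<open>B\<close> the left side is a quadratic with nonnegative leading coefficient
  and the right side is affine, so the ends \<open>3/5\<close> and \<open>21/20\<close>
  suffice.\<close>

lemma first_step_homogeneous:
  fixes r B :: real
  assumes "0 \<le> r" "r \<le> 1" "3/5 \<le> B" "B \<le> 21/20"
  shows "r\<^sup>2 * (1 - r) / 2 + B * (352/10000 * ((1 + r) / 2) ^ 4 + 398/10000 * B * ((1 + r) / 2) ^ 5)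
           \<le> 60/1000 + 525/10000 * B"
proof -
  define s where "s = (B - 3/5) * (20/9)"
  have s: "0 \<le> s" "s \<le> 1" using assms by (auto simp: s_def)
  have B: "B = 3/5 + 9/20 * s" by (simp add: s_def field_simps)
  define t where "t = (1 + r) / 2"
  let ?a = "r\<^sup>2 * (1 - r) / 2" and ?b = "352/10000 * t ^ 4" and ?d = "398/10000 * t ^ 5"
  have "B * B \<le> (1 - s) * (3/5 * (3/5)) + s * (21/20 * (21/20))"
  proof -
    have "0 \<le> 81/400 * (s * (1 - s))" using s by simp
    then show ?thesis unfolding B by (simp add: field_simps)
  qed
  then have "B * B * ?d \<le> ((1 - s) * (3/5 * (3/5)) + s * (21/20 * (21/20))) * ?d"
    using assms by (intro mult_right_mono) (auto simp: t_def)
  then have "?a + B * ?b + B * B * ?d \<le> (1 - s) * (?a + 3/5 * (?b + 3/5 * ?d)) + s * (?a + 21/20 * (?b + 21/20 * ?d))"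
    unfolding B by (simp add: field_simps)
  also have "\<dots> \<le> (1 - s) * (60/1000 + 525/10000 * (3/5)) + s * (60/1000 + 525/10000 * (21/20))"
    using s first_step_min[OF assms(1,2), folded t_def] first_step_max[OF assms(1,2), folded t_def]
    by (intro add_mono[OF mult_left_mono mult_left_mono]) (simp_all add: field_simps)
  also have "\<dots> = 60/1000 + 525/10000 * B"
    unfolding B by (simp add: field_simps)
  finally show ?thesis by (simp add: t_def algebra_simps)
qed

text \<open>\<open>C\<close> may round \<open>B\<close> up, which later permits rational data. If
  the state after the step is at most \<open>1\<close>, raising \<open>B\<close> to \<open>C\<close>
  and scaling by \<open>C\<close> reduces the claim to the homogeneous one; otherwise everything is
  charged at slope \<open>1\<close>.\<close>

lemma first_step:
  assumes "0 \<le> w" "w \<le> 1" "w \<le> z" "z \<le> B" "B \<le> C" "3/5 \<le> C" "C \<le> 21/20"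
  shows "w\<^sup>2 * (B - z) / 2 + potential_ext 3 (B - (B - z) / 2) \<le> start_potential C"
proof (cases "B - (B - z) / 2 \<le> 1")
  case True
  define r where "r = z / C"
  have r: "z = r * C" "0 \<le> r" "r \<le> 1" using assms by (auto simp: r_def)
  define t where "t = (1 + r) / 2"
  have "w\<^sup>2 * (B - z) / 2 \<le> z\<^sup>2 * (C - z) / 2"
    using assms by (intro divide_right_mono mult_mono power_mono) auto
  moreover have "potential 3 (B - (B - z) / 2) \<le> potential 3 (C * t)"
  proof -
    have Ct: "(C + z) / 2 = C * t" unfolding r(1) t_def by (simp add: field_simps)
    have "0 \<le> B - (B - z) / 2" "B - (B - z) / 2 \<le> (C + z) / 2"
      using assms by (simp_all add: field_simps)
    then show ?thesis
      unfolding potential_def Ct by (simp only: if_True refl, intro mult_mono power_mono add_mono) auto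
  qed
  moreover have "z\<^sup>2 * (C - z) / 2 + potential 3 (C * t) = C ^ 3 *
     (r\<^sup>2 * (1 - r) / 2 + C * (352/10000 * t ^ 4 + 398/10000 * C * t ^ 5))"
    unfolding r(1) potential_def power_mult_distrib
    by (simp add: field_simps eval_nat_numeral)
  moreover have "C ^ 3 * (r\<^sup>2 * (1 - r) / 2 + C * (352/10000 * t ^ 4 + 398/10000 * C * t ^ 5))
      \<le> start_potential C"
    unfolding start_potential_def t_def using first_step_homogeneous[of r C] r assms
    by (intro mult_left_mono) auto
  ultimately have "w\<^sup>2 * (B - z) / 2 + potential 3 (B - (B - z) / 2) \<le> start_potential C"
    by linarith
  then show ?thesis using True by (simp add: potential_ext_def)
next
  case False
  have "w\<^sup>2 \<le> 1" using assms by (simp add: power_le_one)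
  then have "w\<^sup>2 * (B - z) \<le> 1 * (B - z)" using assms by (intro mult_right_mono) auto
  then have "w\<^sup>2 * (B - z) / 2 + potential_ext 3 (B - (B - z) / 2) \<le> C - 1 + 75/1000"
  proof -
    have "potential_ext 3 (B - (B - z) / 2) = 75/1000 + (B - (B - z) / 2 - 1)"
      using False by (simp add: potential_ext_def potential_def)
    with \<open>w\<^sup>2 * (B - z) \<le> 1 * (B - z)\<close> \<open>B \<le> C\<close> show ?thesis by linarith
  qed
  \<comment> \<open>\<open>3 * C - 2\<close> is the tangent of \<open>C ^ 3\<close> at
    \<open>1\<close>, and \<open>1125/10000\<close> is \<open>start_potential 1\<close>; the
    comparison relies on \<open>C \<le> 21/20\<close>.\<close>
  also have "\<dots> \<le> (3 * C - 2) * (1125/10000)" using assms by simp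
  also have "\<dots> \<le> start_potential C"
  proof -
    have "2 < B + z" using False by (simp add: field_simps)
    then have C: "1 \<le> C" using \<open>z \<le> B\<close> \<open>B \<le> C\<close> by linarith
    have "C ^ 3 - (3 * C - 2) = (C - 1)\<^sup>2 * (C + 2)"
      by (simp add: algebra_simps power2_eq_square power3_eq_cube)
    also have "\<dots> \<ge> 0" using C by simp
    finally show ?thesis
      unfolding start_potential_def using C by (intro mult_mono) auto
  qed
  finally show ?thesis .
qed

text \<open>\<open>B j\<close> and \<open>z j\<close> stand for the images of the average and of the
  \<open>j\<close>-th value under one affine map. That map enters the bound only through
  \<open>C\<close>.\<close>

lemma weighted_decrement_sum_le:
  fixes B w z :: "nat \<Rightarrow> real"
  assumes rec: "\<And>j. \<lbrakk>2 \<le> j; j \<le> n\<rbrakk> \<Longrightarrow> B j = B (j - 1) - (B (j - 1) - z j) / j"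
    and w: "\<And>j. \<lbrakk>2 \<le> j; j \<le> n\<rbrakk> \<Longrightarrow> 0 \<le> w j \<and> w j \<le> 1 \<and> w j \<le> z j \<and> z j \<le> B (j - 1)"
    and B: "0 \<le> B n" and C: "B 1 \<le> C" "3/5 \<le> C" "C \<le> 21/20"
  shows "(\<Sum>j=2..n. w j ^ j * (B (j - 1) - B j)) \<le> start_potential C"
proof (cases "2 \<le> n")
  case False
  then show ?thesis using C by (simp add: start_potential_def)
next
  case True
  have "(\<Sum>j=2..n. w j ^ j * (B (j - 1) - B j)) = w 2 ^ 2 * (B 1 - B 2) + (\<Sum>j=3..n. w j ^ j * (B (j - 1) - B j))"
    using True by (simp add: sum.atLeast_Suc_atMost numeral_3_eq_3)
  also have "(\<Sum>j=3..n. w j ^ j * (B (j - 1) - B j)) \<le> potential_ext 3 (B (3 - 1))"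
  proof (rule potential_ext_sum[where z = z])
    show "B j = B (j - 1) - (B (j - 1) - z j) / j" if "3 \<le> j" "j \<le> n" for j
      using rec[of j] that by simp
    show "0 \<le> w j \<and> w j \<le> 1 \<and> w j \<le> z j \<and> z j \<le> B (j - 1)" if "3 \<le> j" "j \<le> n" for j
      using w[of j] that by simp
  qed (use B True in auto)
  also have "w 2 ^ 2 * (B 1 - B 2) + potential_ext 3 (B (3 - 1)) \<le> start_potential C"
    using first_step[of "w 2" "z 2" "B 1" C] rec[of 2] w[of 2] True C by simp
  finally show ?thesis by simp
qed

lemma start_potential_convex: "convex_on {0..} start_potential"
proof -
  have "convex_on {0::real..} (\<lambda>x. x ^ 3)" "convex_on {0::real..} (\<lambda>x. x ^ 4)"
    using convex_power_odd[of 3] convex_on_subset[OF convex_power_even[of 4]] by auto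
  then have "convex_on {0..} (\<lambda>x::real. 60/1000 * x ^ 3 + 525/10000 * x ^ 4)"
    by (intro convex_on_add convex_on_cmul) auto
  moreover have "start_potential = (\<lambda>x. 60/1000 * x ^ 3 + 525/10000 * x ^ 4)"
    by (auto simp: start_potential_def algebra_simps eval_nat_numeral)
  ultimately show ?thesis by simp
qed

section \<open>Choosing the tangents\<close>

text \<open>
  The tangent of \<open>ln\<close> at \<open>p\<close> bounds the \<open>w\<^sub>j\<close>, and the tangent at \<open>q\<close> bounds \<open>- x ln x\<close>; the weakening
  of \<open>ln p\<close> to \<open>lam\<close> and of \<open>ln q\<close> to \<open>mu\<close> makes all data rational. Nonnegativity of
  \<open>528/1000 + 472/1000 * lam\<close> keeps the affine bound nonnegative on \<open>[0, 1]\<close>, so that it also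
  covers the values with \<open>w\<^sub>j = 0\<close>.
\<close>
definition tangent_bound :: "real \<Rightarrow> bool" where
  "tangent_bound x \<longleftrightarrow> (\<exists>p lam q mu C. 0 < p \<and> ln p \<le> lam \<and> 0 < q \<and> mu \<le> ln q \<and> 0 \<le> 528/1000 + 472/1000 * lam \<and>
     472/1000 / p * x + (528/1000 + 472/1000 * lam) \<le> C \<and> 3/5 \<le> C \<and> C \<le> 21/20 \<and>
     472/1000 * (q - x - x * mu) + p / (472/1000) * start_potential C \<le> 19/100)"

text \<open>With \<open>p\<close> and \<open>q\<close> fixed, the conditions are affine in
  \<open>x\<close> and \<open>C\<close> apart from the convex \<open>start_potential C\<close>.
  Hence the two ends settle a whole segment, with \<open>C\<close> interpolated between
  \<open>C1\<close> and \<open>C2\<close>.\<close>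

lemma tangent_bound_segment:
  assumes "l \<le> x \<and> x \<le> u" "l < u"
    and p: "0 < p" "ln p \<le> lam" and q: "0 < q" "mu \<le> ln q" and k: "0 \<le> 528/1000 + 472/1000 * lam"
    and C1: "472/1000 / p * l + (528/1000 + 472/1000 * lam) \<le> C1" "3/5 \<le> C1" "C1 \<le> 21/20"
    and C2: "472/1000 / p * u + (528/1000 + 472/1000 * lam) \<le> C2" "3/5 \<le> C2" "C2 \<le> 21/20"
    and v1: "472/1000 * (q - l - l * mu) + p / (472/1000) * start_potential C1 \<le> 19/100"
    and v2: "472/1000 * (q - u - u * mu) + p / (472/1000) * start_potential C2 \<le> 19/100"
  shows "tangent_bound x"
proof -
  define s where "s = (x - l) / (u - l)"
  define C where "C = (1 - s) * C1 + s * C2"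
  have s: "0 \<le> s" "s \<le> 1" using assms(1-2) by (auto simp: s_def)
  have x: "x = (1 - s) * l + s * u"
  proof -
    have "s * (u - l) = x - l" using assms(1-2) by (simp add: s_def)
    then show ?thesis by (simp add: algebra_simps)
  qed
  have mix: "(1 - s) * a + s * b \<le> (1 - s) * a' + s * b'" if "a \<le> a'" "b \<le> b'" for a b a' b' :: real
    using s that by (intro add_mono mult_left_mono) auto
  have same: "(1 - s) * a + s * a = a" for a :: real
    by (simp add: algebra_simps)
  have "start_potential C \<le> (1 - s) * start_potential C1 + s * start_potential C2"
    using convex_onD[OF start_potential_convex, of s C1 C2] s C1 C2 by (simp add: C_def)
  then have "p / (472/1000) * start_potential C \<le> p / (472/1000) * ((1 - s) * start_potential C1 + s * start_potential C2)"
    using p by (intro mult_left_mono) auto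
  then have "472/1000 * (q - x - x * mu) + p / (472/1000) * start_potential C \<le>
      (1 - s) * (472/1000 * (q - l - l * mu) + p / (472/1000) * start_potential C1)
      + s * (472/1000 * (q - u - u * mu) + p / (472/1000) * start_potential C2)"
    unfolding x by (simp add: field_simps)
  also have "\<dots> \<le> (1 - s) * (19/100) + s * (19/100)" by (rule mix[OF v1 v2])
  also have "\<dots> = 19/100" by (rule same)
  finally have "472/1000 * (q - x - x * mu) + p / (472/1000) * start_potential C \<le> 19/100" .
  moreover have "472/1000 / p * x + (528/1000 + 472/1000 * lam) \<le> C"
  proof -
    have "472/1000 / p * x + (528/1000 + 472/1000 * lam)
      = (1 - s) * (472/1000 / p * l + (528/1000 + 472/1000 * lam)) + s * (472/1000 / p * u + (528/1000 + 472/1000 * lam))"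
      unfolding x using p by (simp add: field_simps)
    with mix[OF C1(1) C2(1)] show ?thesis by (simp only: C_def)
  qed
  moreover have "3/5 \<le> C" using mix[OF C1(2) C2(2)] by (simp only: C_def same)
  moreover have "C \<le> 21/20" using mix[OF C1(3) C2(3)] by (simp only: C_def same)
  ultimately show ?thesis
    unfolding tangent_bound_def using p q k by blast
qed

lemma tangent_bound_unit_interval:
  assumes "0 \<le> x" "x \<le> 1"
  shows "tangent_bound x"
proof -
  \<comment> \<open>The subdivision and the tangent points were found numerically.\<close>
  have lp34: "ln (34/100) \<le> (-1078/1000::real)"
    using ln_approx_bounds[of "50/17" 4] ln_inverse[of "50/17"]
    by (simp add: eval_nat_numeral)
  \<comment> \<open>Each logarithm is estimated through the reciprocal argument, which exceeds
    \<open>1\<close>. The \<open>lp\<close> facts bound \<open>ln p\<close> from above, the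
    \<open>lq\<close> facts bound \<open>ln q\<close> from below.\<close>
  have lq37: "(-1::real) \<le> ln (37/100)"
    using ln_approx_bounds[of "100/37" 2] ln_inverse[of "100/37"]
    by (simp add: eval_nat_numeral)
  have lq445: "(-810/1000::real) \<le> ln (445/1000)"
    using ln_approx_bounds[of "200/89" 2] ln_inverse[of "200/89"]
    by (simp add: eval_nat_numeral)
  have lp368: "ln (368/1000) \<le> (-999/1000::real)"
    using ln_approx_bounds[of "125/46" 4] ln_inverse[of "125/46"]
    by (simp add: eval_nat_numeral)
  have lq515: "(-664/1000::real) \<le> ln (515/1000)"
    using ln_approx_bounds[of "200/103" 2] ln_inverse[of "200/103"]
    by (simp add: eval_nat_numeral)
  have lp386: "ln (386/1000) \<le> (-951/1000::real)"
    using ln_approx_bounds[of "500/193" 4] ln_inverse[of "500/193"]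
    by (simp add: eval_nat_numeral)
  have lq56: "(-580/1000::real) \<le> ln (56/100)"
    using ln_approx_bounds[of "25/14" 2] ln_inverse[of "25/14"]
    by (simp add: eval_nat_numeral)
  have lp39: "ln (39/100) \<le> (-941/1000::real)"
    using ln_approx_bounds[of "100/39" 4] ln_inverse[of "100/39"]
    by (simp add: eval_nat_numeral)
  have lq60: "(-511/1000::real) \<le> ln (60/100)"
    using ln_approx_bounds[of "5/3" 2] ln_inverse[of "5/3"]
    by (simp add: eval_nat_numeral)
  have lp412: "ln (412/1000) \<le> (-8867/10000::real)"
    using ln_approx_bounds[of "250/103" 5] ln_inverse[of "250/103"]
    by (simp add: eval_nat_numeral)
  have lq655: "(-4232/10000::real) \<le> ln (655/1000)"
    using ln_approx_bounds[of "200/131" 2] ln_inverse[of "200/131"]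
    by (simp add: eval_nat_numeral)
  have lp448: "ln (448/1000) \<le> (-8029/10000::real)"
    using ln_approx_bounds[of "125/56" 4] ln_inverse[of "125/56"]
    by (simp add: eval_nat_numeral)
  have lq755: "(-2811/10000::real) \<le> ln (755/1000)"
    using ln_approx_bounds[of "200/151" 1] ln_inverse[of "200/151"]
    by (simp add: eval_nat_numeral)
  have lp586: "ln (586/1000) \<le> (-534/1000::real)"
    using ln_approx_bounds[of "500/293" 3] ln_inverse[of "500/293"]
    by (simp add: eval_nat_numeral)
  have lq89: "(-117/1000::real) \<le> ln (89/100)"
    using ln_approx_bounds[of "100/89" 1] ln_inverse[of "100/89"]
    by (simp add: eval_nat_numeral)
  have lp654: "ln (654/1000) \<le> (-424/1000::real)"
    using ln_approx_bounds[of "500/327" 2] ln_inverse[of "500/327"]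
    by (simp add: eval_nat_numeral)
  have lq98: "(-21/1000::real) \<le> ln (98/100)"
    using ln_approx_bounds[of "50/49" 1] ln_inverse[of "50/49"]
    by (simp add: eval_nat_numeral)
  consider "0 \<le> x \<and> x \<le> 4/10" | "4/10 \<le> x \<and> x \<le> 49/100" | "49/100 \<le> x \<and> x \<le> 54/100" | "54/100 \<le> x \<and> x \<le> 58/100" | "58/100 \<le> x \<and> x \<le> 62/100" | "62/100 \<le> x \<and> x \<le> 69/100" | "69/100 \<le> x \<and> x \<le> 82/100" | "82/100 \<le> x \<and> x \<le> 96/100" | "96/100 \<le> x \<and> x \<le> 1"
    using assms by linarith
  then show ?thesis
  proof cases
    case 1
    then show ?thesis
      by (intro tangent_bound_segment[of "0" x "4/10" "34/100" "-1078/1000" "37/100" "-1" "6/10" "6/10"] lp34 lq37)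
        (simp_all add: start_potential_def eval_nat_numeral)
  next
    case 2
    then show ?thesis
      by (intro tangent_bound_segment[of "4/10" x "49/100" "34/100" "-1078/1000" "445/1000" "-810/1000" "6/10" "6995/10000"] lp34 lq445)
        (simp_all add: start_potential_def eval_nat_numeral)
  next
    case 3
    then show ?thesis
      by (intro tangent_bound_segment[of "49/100" x "54/100" "368/1000" "-999/1000" "515/1000" "-664/1000" "685/1000" "7491/10000"] lp368 lq515)
        (simp_all add: start_potential_def eval_nat_numeral)
  next
    case 4
    then show ?thesis
      by (intro tangent_bound_segment[of "54/100" x "58/100" "386/1000" "-951/1000" "56/100" "-580/1000" "7395/10000" "7884/10000"] lp386 lq56)
        (simp_all add: start_potential_def eval_nat_numeral)
  next
    case 5
    then show ?thesis
      by (intro tangent_bound_segment[of "58/100" x "62/100" "39/100" "-941/1000" "60/100" "-511/1000" "7858/10000" "8343/10000"] lp39 lq60)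
        (simp_all add: start_potential_def eval_nat_numeral)
  next
    case 6
    then show ?thesis
      by (intro tangent_bound_segment[of "62/100" x "69/100" "412/1000" "-8867/10000" "655/1000" "-4232/10000" "8198/10000" "9000/10000"] lp412 lq655)
        (simp_all add: start_potential_def eval_nat_numeral)
  next
    case 7
    then show ?thesis
      by (intro tangent_bound_segment[of "69/100" x "82/100" "448/1000" "-8029/10000" "755/1000" "-2811/10000" "8760/10000" "10130/10000"] lp448 lq755)
        (simp_all add: start_potential_def eval_nat_numeral)
  next
    case 8
    then show ?thesis
      by (intro tangent_bound_segment[of "82/100" x "96/100" "586/1000" "-534/1000" "89/100" "-117/1000" "9365/10000" "10492/10000"] lp586 lq89)
        (simp_all add: start_potential_def eval_nat_numeral)
  next
    case 9
    then show ?thesis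
      by (intro tangent_bound_segment[of "96/100" x "1" "654/1000" "-424/1000" "98/100" "-21/1000" "10208/10000" "10496/10000"] lp654 lq98)
        (simp_all add: start_potential_def eval_nat_numeral)
  qed
qed

text \<open>Closed form, for \<open>x \<le> 1\<close>, of the probability that a uniform time meets
  its threshold at value \<open>x\<close>. Nonpositive \<open>x\<close> is separate because
  \<open>ln 0\<close> is not minus infinity.\<close>

definition acceptance_prob :: "real \<Rightarrow> real" where
  "acceptance_prob x = (if x \<le> 0 then 0 else max 0 (1 + 472/1000 * ln x))"

lemma acceptance_prob_le_tangent:
  assumes "0 \<le> x" "0 < p" "ln p \<le> lam" "0 \<le> 528/1000 + 472/1000 * lam"
  shows "acceptance_prob x \<le> 472/1000 / p * x + (528/1000 + 472/1000 * lam)"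
proof (cases "x = 0")
  case True
  then show ?thesis using assms by (simp add: acceptance_prob_def)
next
  case False
  with assms have x: "0 < x" by simp
  have "ln x = ln p + ln (x / p)" using x assms by (simp add: ln_div)
  also have "\<dots> \<le> lam + (x / p - 1)"
    using ln_le_minus_one[of "x / p"] x assms by (intro add_mono) auto
  finally have "ln x \<le> lam + (x / p - 1)" .
  moreover have "472/1000 / p * x = 472/1000 * (x / p)" by simp
  ultimately have "1 + 472/1000 * ln x \<le> 472/1000 / p * x + (528/1000 + 472/1000 * lam)"
    by linarith
  moreover have "0 \<le> 472/1000 / p * x + (528/1000 + 472/1000 * lam)"
    using x assms(2) by (intro add_nonneg_nonneg[OF _ assms(4)]) auto
  ultimately show ?thesis using x by (simp add: acceptance_prob_def)
qed

text \<open>\<open>x\<close> lists the values by rank, \<open>A\<close> their running averages. The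
  tangents supplied for \<open>x 1\<close> bound the two summands: the one at \<open>q\<close> the
  loss on the best item, the one at \<open>p\<close> the sum.\<close>

lemma regret_value_le:
  fixes x A :: "nat \<Rightarrow> real"
  assumes n: "1 \<le> n" and x: "\<And>i. \<lbrakk>1 \<le> i; i \<le> n\<rbrakk> \<Longrightarrow> 0 \<le> x i \<and> x i \<le> 1"
    and dec: "\<And>i. \<lbrakk>1 \<le> i; i < n\<rbrakk> \<Longrightarrow> x (Suc i) \<le> x i"
    and A1: "A 1 = x 1" and A: "\<And>j. \<lbrakk>2 \<le> j; j \<le> n\<rbrakk> \<Longrightarrow> A j = A (j - 1) - (A (j - 1) - x j) / j"
  shows "x 1 * (1 - acceptance_prob (x 1))
           + (\<Sum>j=2..n. acceptance_prob (x j) ^ j * (A (j - 1) - A j)) \<le> 19/100"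
proof -
  have ge: "1 \<le> j \<Longrightarrow> j \<le> n \<Longrightarrow> x j \<le> A j" for j
  proof (induction j rule: nat_induct_at_least[of 1])
    case (Suc j)
    have "x (Suc j) \<le> x j" using dec[of j] Suc by simp
    then have "x (Suc j) \<le> A j" using Suc by simp
    then have "(A j - x (Suc j)) / Suc j \<le> (A j - x (Suc j)) / 1"
      by (intro divide_left_mono) auto
    then show ?case using A[of "Suc j"] Suc by simp
  qed (use A1 in simp)
  have prev: "x j \<le> A (j - 1)" if "2 \<le> j" "j \<le> n" for j
  proof -
    have "1 \<le> j - 1" "j - 1 < n" "Suc (j - 1) = j" using that by arith+
    then show ?thesis using ge[of "j - 1"] dec[of "j - 1"] by simp
  qed
  have x1: "0 \<le> x 1" "x 1 \<le> 1" using x[of 1] n by auto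
  obtain p lam q mu C where t: "0 < p" "ln p \<le> lam" "0 < q" "mu \<le> ln q" "0 \<le> 528/1000 + 472/1000 * lam"
     "472/1000 / p * x 1 + (528/1000 + 472/1000 * lam) \<le> C" "3/5 \<le> C" "C \<le> 21/20"
     "472/1000 * (q - x 1 - x 1 * mu) + p / (472/1000) * start_potential C \<le> 19/100"
    using tangent_bound_unit_interval[OF x1] unfolding tangent_bound_def by blast
  \<comment> \<open>\<open>L\<close> is affine, so it respects the averaging recursion and
    multiplies differences by \<open>k\<close>; dividing by \<open>k\<close> returns to the original
    values.\<close>
  define k where "k = 472/1000 / p"
  define L where "L = (\<lambda>y. k * y + (528/1000 + 472/1000 * lam))"
  have k: "0 < k" "1 / k = p / (472/1000)" using t by (simp_all add: k_def)
  have Lmono: "L a \<le> L b" if "a \<le> b" for a b using that k by (simp add: L_def)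
  have "(\<Sum>j=2..n. acceptance_prob (x j) ^ j * (L (A (j - 1)) - L (A j))) \<le> start_potential C"
  proof (rule weighted_decrement_sum_le[where z = "\<lambda>j. L (x j)" and B = "\<lambda>j. L (A j)"])
    show "L (A j) = L (A (j - 1)) - (L (A (j - 1)) - L (x j)) / j" if "2 \<le> j" "j \<le> n" for j
      by (subst A[OF that]) (simp add: L_def algebra_simps diff_divide_distrib)
    show "0 \<le> acceptance_prob (x j) \<and> acceptance_prob (x j) \<le> 1 \<and> acceptance_prob (x j) \<le> L (x j) \<and> L (x j) \<le> L (A (j - 1))"
      if "2 \<le> j" "j \<le> n" for j
      using acceptance_prob_le_tangent[of "x j" p lam] Lmono[OF prev[OF that]] x[of j] that t
      by (auto simp: acceptance_prob_def L_def k_def)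
    show "0 \<le> L (A n)"
      using ge[of n] x[of n] n k unfolding L_def by (intro add_nonneg_nonneg[OF _ t(5)] mult_nonneg_nonneg) auto
  qed (use t A1 in \<open>simp_all add: L_def k_def\<close>)
  moreover have "(\<Sum>j=2..n. acceptance_prob (x j) ^ j * (L (A (j - 1)) - L (A j)))
      = k * (\<Sum>j=2..n. acceptance_prob (x j) ^ j * (A (j - 1) - A j))"
    unfolding sum_distrib_left by (intro sum.cong) (auto simp: L_def algebra_simps)
  ultimately have "(\<Sum>j=2..n. acceptance_prob (x j) ^ j * (A (j - 1) - A j)) \<le> 1 / k * start_potential C"
    using k by (simp add: field_simps)
  moreover have "x 1 * (1 - acceptance_prob (x 1)) \<le> 472/1000 * (q - x 1 - x 1 * mu)"
  proof (cases "x 1 = 0")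
    case True
    then show ?thesis using t by simp
  next
    case False
    with x1 have pos: "0 < x 1" by simp
    \<comment> \<open>Multiplied by \<open>x 1\<close>, this is the tangent bound for
      \<open>- y * ln y\<close> at \<open>q\<close>, with \<open>ln q\<close> weakened to
      \<open>mu\<close>.\<close>
    have "- ln (x 1) \<le> q / x 1 - 1 - mu"
      using ln_le_minus_one[of "q / x 1"] pos t by (simp add: ln_div)
    then have "x 1 * - ln (x 1) \<le> x 1 * (q / x 1 - 1 - mu)"
      using pos by (intro mult_left_mono) auto
    also have "\<dots> = q - x 1 - x 1 * mu" using pos by (simp add: field_simps)
    finally have 1: "472/1000 * (x 1 * - ln (x 1)) \<le> 472/1000 * (q - x 1 - x 1 * mu)" by simp
    have "1 - acceptance_prob (x 1) \<le> 472/1000 * - ln (x 1)"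
      using pos by (simp add: acceptance_prob_def)
    then have "x 1 * (1 - acceptance_prob (x 1)) \<le> x 1 * (472/1000 * - ln (x 1))"
      using pos by (intro mult_left_mono) auto
    with 1 show ?thesis by (simp only: mult.left_commute[of "x 1" "472/1000"])
  qed
  ultimately show ?thesis unfolding k(2) using t(9) by linarith
qed

section \<open>The picked value as a telescoping sum\<close>

text \<open>The sum over candidates lets the expectation be taken termwise. A shared earliest time
  gives \<open>0\<close>, but this is a null event; an empty \<open>K\<close> also gives
  \<open>0\<close>.\<close>

definition first_value :: "(nat \<Rightarrow> real) \<Rightarrow> nat set \<Rightarrow> (nat \<Rightarrow> real) \<Rightarrow> real" where
  "first_value x K t = (\<Sum>k\<in>K. x k * of_bool (\<forall>j\<in>K - {k}. t k < t j))"

text \<open>\<open>acceptable\<close> relative to an arbitrary set of items and an abstract ranking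
  \<open>R\<close>, so that items can be added one at a time.\<close>

definition accepted_among ::
    "(nat \<Rightarrow> nat \<Rightarrow> bool) \<Rightarrow> (real \<Rightarrow> real) \<Rightarrow> (nat \<Rightarrow> real) \<Rightarrow> nat set \<Rightarrow> (nat \<Rightarrow> real) \<Rightarrow> nat set" where
  "accepted_among R f x S t = {i\<in>S. f (t i) \<le> x i \<and> (\<forall>j\<in>S. t j < t i \<longrightarrow> R i j)}"

definition payoff_among ::
    "(nat \<Rightarrow> nat \<Rightarrow> bool) \<Rightarrow> (real \<Rightarrow> real) \<Rightarrow> (nat \<Rightarrow> real) \<Rightarrow> nat set \<Rightarrow> (nat \<Rightarrow> real) \<Rightarrow> real" where
  "payoff_among R f x S t = payoff x (if accepted_among R f x S t = {} then None
      else Some (arg_min_on t (accepted_among R f x S t)))"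

lemma arg_min_on_eqI:
  fixes t :: "'a \<Rightarrow> real"
  assumes "finite B" "inj_on t B" "b \<in> B" "\<And>y. y \<in> B \<Longrightarrow> t b \<le> t y"
  shows "arg_min_on t B = b"
proof -
  have ne: "B \<noteq> {}" using assms by auto
  have "arg_min_on t B \<in> B" "\<not> t b < t (arg_min_on t B)"
    using arg_min_if_finite[OF assms(1) ne, of t] assms(3) by auto
  moreover have "t b \<le> t (arg_min_on t B)" using assms calculation by blast
  moreover have "t (arg_min_on t B) \<le> t b"
    using arg_min_least[OF assms(1) ne assms(3)] .
  ultimately show ?thesis using assms(2,3) by (auto dest: inj_onD)
qed

lemma first_value_eq:
  assumes "finite K" "inj_on t K" "m \<in> K" "\<And>j. j \<in> K \<Longrightarrow> t m \<le> t j"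
  shows "first_value x K t = x m"
proof -
  have "(\<forall>j\<in>K - {k}. t k < t j) \<longleftrightarrow> k = m" if "k \<in> K" for k
  proof
    assume "\<forall>j\<in>K - {k}. t k < t j"
    then show "k = m" using assms(3) assms(4)[OF that] by (metis DiffI empty_iff insert_iff not_less)
  next
    assume "k = m"
    then show "\<forall>j\<in>K - {k}. t k < t j"
      using assms by (metis DiffE inj_onD insertI1 order_le_less)
  qed
  then have "first_value x K t = (\<Sum>k\<in>K. if k = m then x k else 0)"
    unfolding first_value_def by (intro sum.cong) auto
  then show ?thesis using assms by simp
qed

text \<open>
  If \<open>a\<close>, ranked below \<open>S\<close>, arrives first and meets its threshold, then every item of \<open>S\<close> meets
  its threshold too; hence the pick from \<open>S\<close> alone is the first arrival in \<open>S\<close>.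
\<close>
lemma payoff_among_insert:
  assumes S: "finite S" "a \<notin> S" and inj: "inj_on t (insert a S)"
    and R: "\<And>j. j \<in> S \<Longrightarrow> R j a" "\<And>j. j \<in> S \<Longrightarrow> \<not> R a j"
    and x: "\<And>j. j \<in> S \<Longrightarrow> x a \<le> x j" and f: "antimono f"
  shows "payoff_among R f x (insert a S) t = payoff_among R f x S t
    + of_bool (\<forall>i\<in>insert a S. f (t i) \<le> x a) * (first_value x (insert a S) t - first_value x S t)"
proof -
  have injS: "inj_on t S" using inj by (rule inj_on_subset) auto
  have acc_sub: "accepted_among R f x S' t \<subseteq> S'" for S' by (auto simp: accepted_among_def)
  \<comment> \<open>\<open>R j a\<close> keeps \<open>a\<close> from blocking any item of
    \<open>S\<close>, and \<open>a\<close> itself passes only when nothing in \<open>S\<close>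
    precedes it.\<close>
  have acc: "accepted_among R f x (insert a S) t = accepted_among R f x S t \<union>
      (if f (t a) \<le> x a \<and> (\<forall>j\<in>S. \<not> t j < t a) then {a} else {})"
    using R S by (auto simp: accepted_among_def)
  consider (later) j where "j \<in> S" "t j < t a" | (first) "\<forall>j\<in>S. \<not> t j < t a" by auto
  then show ?thesis
  proof cases
    case later
    define m where "m = arg_min_on t S"
    have m: "m \<in> S" "\<And>j. j \<in> S \<Longrightarrow> t m \<le> t j"
      using arg_min_if_finite(1)[of S t] arg_min_least[of S _ t] later S by (auto simp: m_def)
    have "first_value x (insert a S) t = first_value x S t"
      using first_value_eq[of "insert a S" t m x] first_value_eq[of S t m x] m later S inj injS
      by fastforce
    moreover have "accepted_among R f x (insert a S) t = accepted_among R f x S t"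
      using acc later by auto
    ultimately show ?thesis by (simp add: payoff_among_def)
  next
    case first
    show ?thesis
    proof (cases "f (t a) \<le> x a")
      case False
      then show ?thesis using acc by (simp add: payoff_among_def)
    next
      case True
      have min_a: "t a \<le> t j" if "j \<in> insert a S" for j using first that by auto
      \<comment> \<open>\<open>t a\<close> is the least time and \<open>f\<close> is antitone, so
        the threshold condition at \<open>a\<close> alone implies it for every time. The condition
        on all times is symmetric in the items, which the expectation exploits.\<close>
      have all: "f (t i) \<le> x a" if "i \<in> insert a S" for i
        using antimonoD[OF f min_a[OF that]] True by simp
      have accept: "accepted_among R f x (insert a S) t = insert a (accepted_among R f x S t)"
        using acc True first by auto
      have "arg_min_on t (insert a (accepted_among R f x S t)) = a"
        using acc_sub[of S] S min_a by (intro arg_min_on_eqI inj_on_subset[OF inj]) (auto intro: finite_subset)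
      then have "payoff_among R f x (insert a S) t = x a"
        by (simp add: payoff_among_def accept payoff_def)
      moreover have "first_value x (insert a S) t = x a"
        using S inj min_a by (intro first_value_eq) auto
      moreover have "payoff_among R f x S t = first_value x S t"
      proof (cases "S = {}")
        case True
        then show ?thesis by (simp add: payoff_among_def accepted_among_def first_value_def payoff_def)
      next
        case False
        define m where "m = arg_min_on t S"
        have m: "m \<in> S" "\<And>j. j \<in> S \<Longrightarrow> t m \<le> t j"
          using arg_min_if_finite(1)[of S t] arg_min_least[of S _ t] False S by (auto simp: m_def)
        have "m \<in> accepted_among R f x S t"
          using m all[of m] x[of m] by (force simp: accepted_among_def)
        moreover from this have "arg_min_on t (accepted_among R f x S t) = m"
          using acc_sub[of S] S m by (intro arg_min_on_eqI inj_on_subset[OF injS]) (auto intro: finite_subset)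
        ultimately have "payoff_among R f x S t = x m"
          by (auto simp: payoff_among_def payoff_def)
        then show ?thesis using first_value_eq[of S t m x] S injS m by simp
      qed
      ultimately show ?thesis using all by simp
    qed
  qed
qed

text \<open>The items of \<open>l\<close> are added from best to worst. Index \<open>j\<close> has
  rank \<open>j + 1\<close>, so its threshold event involves the \<open>Suc j\<close> times of the
  prefix up to it.\<close>

lemma payoff_among_telescope:
  assumes "distinct l" "inj_on t (set l)" "antimono f"
    and R: "\<And>i j. \<lbrakk>i < j; j < length l\<rbrakk> \<Longrightarrow> R (l ! i) (l ! j) \<and> \<not> R (l ! j) (l ! i)"
    and x: "\<And>i j. \<lbrakk>i < j; j < length l\<rbrakk> \<Longrightarrow> x (l ! j) \<le> x (l ! i)"
    and "m \<le> length l"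
  shows "payoff_among R f x (set (take m l)) t = (\<Sum>j<m. of_bool (\<forall>i\<in>set (take (Suc j) l). f (t i) \<le> x (l ! j))
      * (first_value x (set (take (Suc j) l)) t - first_value x (set (take j l)) t))"
  using \<open>m \<le> length l\<close>
proof (induction m)
  case 0
  then show ?case by (simp add: payoff_among_def accepted_among_def payoff_def)
next
  case (Suc m)
  then have m: "m < length l" by simp
  have take: "set (take (Suc m) l) = insert (l ! m) (set (take m l))"
    using m by (simp add: take_Suc_conv_app_nth)
  have nth: "\<exists>i<m. j = l ! i" if "j \<in> set (take m l)" for j
    using that m by (auto simp: in_set_conv_nth)
  have "l ! m \<notin> set (take m l)"
    using nth[of "l ! m"] m assms(1) by (auto simp: nth_eq_iff_index_eq)
  then have "payoff_among R f x (set (take (Suc m) l)) t = payoff_among R f x (set (take m l)) t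
    + of_bool (\<forall>i\<in>set (take (Suc m) l). f (t i) \<le> x (l ! m))
      * (first_value x (set (take (Suc m) l)) t - first_value x (set (take m l)) t)"
    unfolding take
  proof (intro payoff_among_insert)
    show "inj_on t (insert (l ! m) (set (take m l)))"
      using inj_on_subset[OF assms(2) set_take_subset[of "Suc m" l]] take by simp
    show "R j (l ! m)" "\<not> R (l ! m) j" "x (l ! m) \<le> x j" if "j \<in> set (take m l)" for j
      using nth[OF that] R x m by auto
  qed (use assms(3) in auto)
  with Suc show ?case by simp
qed

section \<open>The expected payoff\<close>

abbreviation unif :: "real measure" where
  "unif \<equiv> uniform_measure lborel {0..1}"

lemma prob_space_unif: "prob_space unif"
  by (intro prob_space_uniform_measure) auto

lemma prob_space_arrival_times: "prob_space (arrival_times n)"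
  unfolding arrival_times_def by (intro prob_space_PiM prob_space_unif)

lemma sets_arrival_times: "sets (arrival_times n) = sets (\<Pi>\<^sub>M i\<in>{1..n}. borel)"
  unfolding arrival_times_def by (intro sets_PiM_cong) auto

lemma space_arrival_times: "space (arrival_times n) = {1..n} \<rightarrow>\<^sub>E UNIV"
  unfolding arrival_times_def by (simp add: space_PiM)

lemma measurable_arrival_time [measurable]:
  "i \<in> {1..n} \<Longrightarrow> (\<lambda>t. t i) \<in> borel_measurable (arrival_times n)"
  by (subst measurable_cong_sets[OF sets_arrival_times refl]) (rule measurable_component_singleton)

lemma pred_less_arrival_times:
  assumes "i \<in> {1..n}" "j \<in> {1..n}"
  shows "Measurable.pred (arrival_times n) (\<lambda>t. t i < t j)"
  using measurable_arrival_time[OF assms(1)] measurable_arrival_time[OF assms(2)] by measurable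

text \<open>
  \<^const>\<open>arg_min_on\<close> picks an arbitrary minimizer; the pick is measurable because it depends on \<open>t\<close>
  only through the set of minimizers.
\<close>
lemma measurable_payoff_among:
  assumes S: "S \<subseteq> {1..n}" and f: "f \<in> borel_measurable borel"
  shows "payoff_among R f x S \<in> borel_measurable (arrival_times n)"
proof -
  let ?M = "arrival_times n"
  define D where "D = (\<lambda>t. {i. is_arg_min t (\<lambda>i. i \<in> accepted_among R f x S t) i})"
  define g where "g = (\<lambda>A. if A = {} then 0 else x (SOME i. i \<in> A))"
  have fin: "finite S" using S finite_subset by auto
  have g: "payoff_among R f x S t = g (D t)" for t
  proof (cases "accepted_among R f x S t = {}")
    case True
    then have "D t = {}" by (auto simp: D_def is_arg_min_def)
    with True show ?thesis by (simp add: g_def payoff_among_def payoff_def)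
  next
    case False
    have "finite (accepted_among R f x S t)" using fin by (auto simp: accepted_among_def)
    from arg_min_if_finite[OF this False, of t]
    have "arg_min_on t (accepted_among R f x S t) \<in> D t"
      by (auto simp: D_def is_arg_min_def)
    then have "D t \<noteq> {}" by auto
    with False show ?thesis
      by (auto simp: g_def payoff_among_def payoff_def arg_min_on_def arg_min_def D_def)
  qed
  have D: "D t \<subseteq> S" for t by (auto simp: D_def is_arg_min_def accepted_among_def)
  have acc: "Measurable.pred ?M (\<lambda>t. i \<in> accepted_among R f x S t)" if "i \<in> S" for i
  proof -
    have [measurable]: "(\<lambda>t. f (t i)) \<in> borel_measurable ?M"
      using measurable_compose[OF measurable_arrival_time f] that S by auto
    have [measurable]: "Measurable.pred ?M (\<lambda>t. t j < t i)" if "j \<in> S" for j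
      using \<open>i \<in> S\<close> that S by (intro pred_less_arrival_times) auto
    have "Measurable.pred ?M (\<lambda>t. f (t i) \<le> x i \<and> (\<forall>j\<in>S. t j < t i \<longrightarrow> R i j))"
      using fin by measurable
    then show ?thesis using that by (simp add: accepted_among_def)
  qed
  have memD: "Measurable.pred ?M (\<lambda>t. i \<in> D t)" for i
  proof (cases "i \<in> S")
    case True
    have [measurable]: "Measurable.pred ?M (\<lambda>t. t j < t i)" if "j \<in> S" for j
      using True that S by (intro pred_less_arrival_times) auto
    note acc[measurable]
    have "Measurable.pred ?M (\<lambda>t. i \<in> accepted_among R f x S t \<and> (\<forall>j\<in>S. \<not> (j \<in> accepted_among R f x S t \<and> t j < t i)))"
      using fin True by measurable
    moreover have "i \<in> D t \<longleftrightarrow> i \<in> accepted_among R f x S t \<and> (\<forall>j\<in>S. \<not> (j \<in> accepted_among R f x S t \<and> t j < t i))" for t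
      by (auto simp: D_def is_arg_min_def accepted_among_def)
    ultimately show ?thesis by simp
  next
    case False
    then have "i \<in> D t \<longleftrightarrow> False" for t using D by auto
    then show ?thesis by simp
  qed
  \<comment> \<open>\<open>D\<close> takes finitely many values, each described by measurable
    membership conditions, so the payoff is a finite combination of indicators.\<close>
  have eq: "payoff_among R f x S t = (\<Sum>A\<in>Pow S. g A * of_bool (\<forall>i\<in>S. i \<in> D t \<longleftrightarrow> i \<in> A))" for t
  proof -
    have "(\<forall>i\<in>S. i \<in> D t \<longleftrightarrow> i \<in> A) \<longleftrightarrow> D t = A" if "A \<in> Pow S" for A using D[of t] that by auto
    then have "(\<Sum>A\<in>Pow S. g A * of_bool (\<forall>i\<in>S. i \<in> D t \<longleftrightarrow> i \<in> A)) = (\<Sum>A\<in>Pow S. if A = D t then g A else 0)"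
      by (intro sum.cong) auto
    also have "\<dots> = g (D t)" using D[of t] fin by simp
    finally show ?thesis using g by simp
  qed
  show ?thesis
    unfolding eq[abs_def] using memD fin
    by (intro borel_measurable_sum borel_measurable_times borel_measurable_const) measurable
qed

text \<open>Integrating over coordinate \<open>i\<close> first, with the others fixed, the event
  requires \<open>t i\<close> to hit a single point, which is null.\<close>

lemma AE_arrival_times_distinct:
  assumes "i \<in> {1..n}" "j \<in> {1..n}" "i \<noteq> j"
  shows "AE t in arrival_times n. t i \<noteq> t j"
proof -
  interpret U: prob_space unif by (rule prob_space_unif)
  interpret P: product_sigma_finite "\<lambda>_. unif" by standard
  let ?J = "{1..n} - {i}"
  have ins: "{1..n} = insert i ?J" using assms by auto
  have M: "arrival_times n = Pi\<^sub>M (insert i ?J) (\<lambda>_. unif)"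
    unfolding arrival_times_def using ins by simp
  have [measurable]: "(\<lambda>t. t i) \<in> borel_measurable (arrival_times n)" "(\<lambda>t. t j) \<in> borel_measurable (arrival_times n)"
    using assms by auto
  have [measurable]: "Measurable.pred (arrival_times n) (\<lambda>t. t i = t j)"
    unfolding pred_def by (rule borel_measurable_eq) measurable
  have meas: "(\<lambda>t. indicator {t. t i = t j} t :: ennreal) \<in> borel_measurable (arrival_times n)"
    by measurable
  have "(\<integral>\<^sup>+t. indicator {t. t i = t j} t \<partial>arrival_times n)
     = (\<integral>\<^sup>+t. \<integral>\<^sup>+y. indicator {t. t i = t j} (t(i := y)) \<partial>unif \<partial>Pi\<^sub>M ?J (\<lambda>_. unif))"
    using meas unfolding M by (intro P.product_nn_integral_insert) auto
  also have "\<dots> = (\<integral>\<^sup>+t. \<integral>\<^sup>+y. indicator {t j} y \<partial>unif \<partial>Pi\<^sub>M ?J (\<lambda>_. unif))"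
    using assms by (intro nn_integral_cong) (auto simp: indicator_def)
  also have "\<dots> = 0"
  proof -
    have "emeasure unif {y} = 0" for y :: real
    proof -
      have "emeasure lborel ({0..1} \<inter> {y}) = 0"
        by (rule emeasure_lborel_countable) auto
      then show ?thesis by (simp add: emeasure_uniform_measure)
    qed
    then show ?thesis by simp
  qed
  finally have "(\<integral>\<^sup>+t. indicator {t. t i = t j} t \<partial>arrival_times n) = 0" .
  then have "AE t in arrival_times n. indicator {t. t i = t j} t = (0::ennreal)"
    using meas by (subst (asm) nn_integral_0_iff_AE) auto
  then show ?thesis by (rule AE_mp) (auto simp: indicator_def split: if_splits)
qed

lemma AE_arrival_times_inj: "AE t in arrival_times n. inj_on t {1..n}"
proof -
  have "AE t in arrival_times n. \<forall>i\<in>{1..n}. \<forall>j\<in>{1..n}. i \<noteq> j \<longrightarrow> t i \<noteq> t j"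
    by (intro AE_finite_allI AE_impI AE_arrival_times_distinct finite_atLeastAtMost)
  then show ?thesis by eventually_elim (auto simp: inj_on_def)
qed

section \<open>Threshold events jointly with the first arrival\<close>

lemma pred_all_below:
  fixes f :: "real \<Rightarrow> real"
  assumes "S \<subseteq> {1..n}" "f \<in> borel_measurable borel"
  shows "Measurable.pred (arrival_times n) (\<lambda>t. \<forall>i\<in>S. f (t i) \<le> y)"
proof -
  have "(\<lambda>t. f (t i)) \<in> borel_measurable (arrival_times n)" if "i \<in> S" for i
    using measurable_compose[OF measurable_arrival_time assms(2)] that assms by auto
  then have "Measurable.pred (arrival_times n) (\<lambda>t. f (t i) \<le> y)" if "i \<in> S" for i
    using that unfolding pred_def by (intro borel_measurable_le borel_measurable_const)
  moreover have "finite S" using assms finite_subset by auto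
  ultimately show ?thesis by (intro pred_intros_finite) auto
qed

lemma pred_first_arrival:
  assumes "K \<subseteq> {1..n}" "k \<in> K"
  shows "Measurable.pred (arrival_times n) (\<lambda>t. \<forall>j\<in>K - {k}. t k < t j)"
proof -
  have "finite (K - {k})" using assms(1) finite_subset by auto
  then show ?thesis
    using assms by (intro pred_intros_finite pred_less_arrival_times) auto
qed

lemma measurable_first_value:
  assumes "K \<subseteq> {1..n}"
  shows "first_value x K \<in> borel_measurable (arrival_times n)"
proof -
  have "(\<lambda>t. of_bool (\<forall>j\<in>K - {k}. t k < t j) :: real) \<in> borel_measurable (arrival_times n)" if "k \<in> K" for k
    using pred_first_arrival[OF assms that] by measurable
  then show ?thesis
    unfolding first_value_def[abs_def] by (intro borel_measurable_sum borel_measurable_times borel_measurable_const)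
qed

lemma prob_all_below:
  fixes f :: "real \<Rightarrow> real"
  assumes S: "S \<subseteq> {1..n}" and f: "f \<in> borel_measurable borel"
  shows "measure (arrival_times n) {t\<in>space (arrival_times n). \<forall>i\<in>S. f (t i) \<le> y} = measure unif {s. f s \<le> y} ^ card S"
proof -
  interpret U: prob_space unif by (rule prob_space_unif)
  interpret P: finite_product_prob_space "\<lambda>_. unif" "{1..n}"
    by standard auto
  let ?A = "\<lambda>i. if i \<in> S then {s. f s \<le> y} else UNIV"
  have meas: "{s. f s \<le> y} \<in> sets borel"
    using borel_measurable_le[OF f borel_measurable_const[of y]] by simp
  have "{t\<in>space (arrival_times n). \<forall>i\<in>S. f (t i) \<le> y} = (\<Pi>\<^sub>E i\<in>{1..n}. ?A i)"
    using S by (auto simp: space_arrival_times PiE_iff extensional_def split: if_splits)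
  also have "measure (arrival_times n) \<dots> = (\<Prod>i\<in>{1..n}. measure unif (?A i))"
    unfolding arrival_times_def using meas by (intro P.finite_measure_PiM_emb) auto
  also have "\<dots> = (\<Prod>i\<in>{1..n}. if i \<in> S then measure unif {s. f s \<le> y} else 1)"
    using U.prob_space by (intro prod.cong) auto
  also have "\<dots> = (\<Prod>i\<in>{1..n} \<inter> S. measure unif {s. f s \<le> y})"
    by (subst prod.inter_restrict) auto
  also have "{1..n} \<inter> S = S" using S by auto
  finally show ?thesis by simp
qed

text \<open>Swapping two arrival times preserves their joint distribution.\<close>
lemma prob_first_arrival_symmetric:
  fixes f :: "real \<Rightarrow> real"
  assumes S: "S \<subseteq> {1..n}" and K: "K \<subseteq> S" and k: "k \<in> K" "k' \<in> K" and f: "f \<in> borel_measurable borel"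
  shows "measure (arrival_times n) {t\<in>space (arrival_times n). (\<forall>i\<in>S. f (t i) \<le> y) \<and> (\<forall>j\<in>K - {k}. t k < t j)}
       = measure (arrival_times n) {t\<in>space (arrival_times n). (\<forall>i\<in>S. f (t i) \<le> y) \<and> (\<forall>j\<in>K - {k'}. t k' < t j)}"
    (is "measure ?M (?E k) = measure ?M (?E k')")
proof -
  define \<pi> where "\<pi> = Transposition.transpose k k'"
  define \<phi> where "\<phi> = (\<lambda>t. \<lambda>i\<in>{1..n}. t (\<pi> i) :: real)"
  have \<pi>_in: "\<pi> i \<in> T \<longleftrightarrow> i \<in> T" if "k \<in> T" "k' \<in> T" for T i
    using that by (auto simp: \<pi>_def Transposition.transpose_def)
  have \<pi>\<pi>: "\<pi> (\<pi> i) = i" for i by (simp add: \<pi>_def)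
  have kn: "k \<in> {1..n}" "k' \<in> {1..n}" using k K S by auto
  have kS: "k \<in> S" "k' \<in> S" using k K by auto
  have distr: "distr ?M ?M \<phi> = ?M"
    unfolding arrival_times_def \<phi>_def
    using \<pi>_in[OF kn] by (intro distr_PiM_reindex prob_space_unif) (auto simp: \<pi>_def)
  have \<phi>: "\<phi> \<in> measurable ?M ?M"
    unfolding \<phi>_def arrival_times_def using \<pi>_in[OF kn]
    by (intro measurable_restrict measurable_component_singleton) auto
  have E: "?E k' \<in> sets ?M"
    using pred_all_below[OF S f, of y] pred_first_arrival[OF subset_trans[OF K S] k(2)] by measurable
  have below: "(\<forall>i\<in>S. f (\<phi> t i) \<le> y) \<longleftrightarrow> (\<forall>i\<in>S. f (t i) \<le> y)" for t
  proof -
    have "\<phi> t i = t (\<pi> i)" if "i \<in> S" for i using that S by (auto simp: \<phi>_def)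
    then have "(\<forall>i\<in>S. f (\<phi> t i) \<le> y) \<longleftrightarrow> (\<forall>i\<in>S. f (t (\<pi> i)) \<le> y)" by auto
    also have "\<dots> \<longleftrightarrow> (\<forall>i\<in>S. f (t i) \<le> y)" by (metis \<pi>_in[OF kS] \<pi>\<pi>)
    finally show ?thesis .
  qed
  have first: "(\<forall>j\<in>K - {k'}. \<phi> t k' < \<phi> t j) \<longleftrightarrow> (\<forall>j\<in>K - {k}. t k < t j)" for t
  proof -
    have \<pi>k: "\<pi> k' = k" by (simp add: \<pi>_def)
    have "\<phi> t i = t (\<pi> i)" if "i \<in> K" for i using that K S by (auto simp: \<phi>_def)
    then have "(\<forall>j\<in>K - {k'}. \<phi> t k' < \<phi> t j) \<longleftrightarrow> (\<forall>j\<in>K - {k'}. t k < t (\<pi> j))" using k \<pi>k by auto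
    also have "\<dots> \<longleftrightarrow> (\<forall>j\<in>K - {k}. t k < t j)"
      by (metis DiffE DiffI \<pi>_in[OF k] \<pi>\<pi> \<pi>k insertCI singletonD)
    finally show ?thesis .
  qed
  have "measure ?M (?E k') = measure ?M (\<phi> -` ?E k' \<inter> space ?M)"
    using measure_distr[OF \<phi> E] distr by simp
  also have "\<phi> -` ?E k' \<inter> space ?M = ?E k"
    using below first measurable_space[OF \<phi>] by auto
  finally show ?thesis by simp
qed

text \<open>The threshold event on \<open>S\<close> is symmetric, so together with it each item of
  \<open>K\<close> is equally likely to arrive first. Almost surely exactly one does, hence each has
  the share \<open>1 / card K\<close>.\<close>

lemma expectation_first_value:
  fixes f :: "real \<Rightarrow> real"
  assumes S: "S \<subseteq> {1..n}" and K: "K \<subseteq> S" and f: "f \<in> borel_measurable borel"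
  shows "(\<integral>t. of_bool (\<forall>i\<in>S. f (t i) \<le> y) * first_value x K t \<partial>arrival_times n)
     = measure unif {s. f s \<le> y} ^ card S * ((\<Sum>k\<in>K. x k) / card K)"
proof (cases "K = {}")
  case True
  \<comment> \<open>For empty \<open>K\<close> both sides are \<open>0\<close>, since division by
    zero yields \<open>0\<close>.\<close>
  then show ?thesis by (simp add: first_value_def)
next
  case False
  let ?M = "arrival_times n"
  interpret prob_space ?M by (rule prob_space_arrival_times)
  define E where "E = (\<lambda>k. {t\<in>space ?M. (\<forall>i\<in>S. f (t i) \<le> y) \<and> (\<forall>j\<in>K - {k}. t k < t j)})"
  have finK: "finite K" using K S finite_subset by (metis finite_atLeastAtMost)
  have E: "E k \<in> sets ?M" if "k \<in> K" for k
    unfolding E_def using pred_all_below[OF S f, of y] pred_first_arrival[OF subset_trans[OF K S] that] by measurable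
  have expand: "(\<integral>t. of_bool (\<forall>i\<in>S. f (t i) \<le> y) * first_value z K t \<partial>?M) = (\<Sum>k\<in>K. z k * prob (E k))" for z
  proof -
    have "(\<integral>t. of_bool (\<forall>i\<in>S. f (t i) \<le> y) * first_value z K t \<partial>?M) = (\<integral>t. (\<Sum>k\<in>K. z k * indicator (E k) t) \<partial>?M)"
      unfolding first_value_def sum_distrib_left
      by (intro Bochner_Integration.integral_cong sum.cong refl) (auto simp: E_def indicator_def)
    also have "\<dots> = (\<Sum>k\<in>K. \<integral>t. z k * indicator (E k) t \<partial>?M)"
      using E by (intro Bochner_Integration.integral_sum integrable_mult_right integrable_real_indicator) (auto simp: emeasure_eq_measure)
    also have "\<dots> = (\<Sum>k\<in>K. z k * prob (E k))"
      using E sets.sets_into_space by (intro sum.cong) (auto simp: Int_absorb2)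
    finally show ?thesis .
  qed
  obtain k0 where k0: "k0 \<in> K" using False by auto
  have const: "prob (E k) = prob (E k0)" if "k \<in> K" for k
    unfolding E_def by (rule prob_first_arrival_symmetric[OF S K that k0 f])
  \<comment> \<open>The expansion with all values equal to \<open>1\<close> determines the common
    probability.\<close>
  have "(\<Sum>k\<in>K. 1 * prob (E k)) = (\<integral>t. of_bool (\<forall>i\<in>S. f (t i) \<le> y) * first_value (\<lambda>_. 1) K t \<partial>?M)"
    using expand[of "\<lambda>_. 1"] by simp
  also have "\<dots> = (\<integral>t. indicator {t\<in>space ?M. \<forall>i\<in>S. f (t i) \<le> y} t \<partial>?M)"
  proof (rule integral_cong_AE)
    show "(\<lambda>t. of_bool (\<forall>i\<in>S. f (t i) \<le> y) * first_value (\<lambda>_. 1) K t) \<in> borel_measurable ?M"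
      using pred_all_below[OF S f, of y] measurable_first_value[OF subset_trans[OF K S], of "\<lambda>_. 1"] by measurable
    show "(\<lambda>t. indicator {t\<in>space ?M. \<forall>i\<in>S. f (t i) \<le> y} t :: real) \<in> borel_measurable ?M"
      using pred_all_below[OF S f, of y] by measurable
    show "AE t in ?M. of_bool (\<forall>i\<in>S. f (t i) \<le> y) * first_value (\<lambda>_. 1) K t
        = (indicator {t\<in>space ?M. \<forall>i\<in>S. f (t i) \<le> y} t :: real)"
      using AE_arrival_times_inj AE_space
    proof eventually_elim
      case (elim t)
      define m where "m = arg_min_on t K"
      have "m \<in> K" "\<And>j. j \<in> K \<Longrightarrow> t m \<le> t j"
        using arg_min_if_finite(1)[of K t] arg_min_least[of K _ t] False finK by (auto simp: m_def)
      then have "first_value (\<lambda>_. 1) K t = 1"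
        using first_value_eq[of K t m "\<lambda>_. 1"] finK inj_on_subset[OF elim(1), of K] K S by auto
      then show ?case using elim by (auto simp: indicator_def)
    qed
  qed
  also have "\<dots> = measure unif {s. f s \<le> y} ^ card S"
    using prob_all_below[OF S f, of y] pred_all_below[OF S f, of y] by (simp add: Int_def conj_ac)
  finally have "card K * prob (E k0) = measure unif {s. f s \<le> y} ^ card S"
    using const by simp
  moreover have "(\<Sum>k\<in>K. x k * prob (E k)) = (\<Sum>k\<in>K. x k) * prob (E k0)"
    using const by (simp add: sum_distrib_right)
  moreover have "card K \<noteq> 0" using False finK by simp
  ultimately show ?thesis
    unfolding expand by (simp add: field_simps)
qed

lemma sum_set_take_nth:
  assumes "distinct l" "m \<le> length l"
  shows "(\<Sum>k\<in>set (take m l). x k) = (\<Sum>i<m. x (l ! i))"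
proof -
  have "set (take m l) = (!) l ` {..<m}"
    using assms(2) by (simp add: nth_image[symmetric] lessThan_atLeast0)
  moreover have "inj_on ((!) l) {..<m}"
    using assms by (intro inj_onI) (auto simp: nth_eq_iff_index_eq)
  ultimately show ?thesis by (simp add: sum.reindex)
qed

text \<open>Termwise expectation of the telescoping sum. Both first values in a term carry the event
  on the larger prefix, hence the common power \<open>Suc j\<close>; at \<open>j = 0\<close> the
  subtracted average is \<open>0 / 0 = 0\<close>.\<close>

lemma expectation_payoff_among:
  assumes l: "distinct l" "set l = {1..n}" and f: "antimono f" "f \<in> borel_measurable borel"
    and R: "\<And>i j. \<lbrakk>i < j; j < length l\<rbrakk> \<Longrightarrow> R (l ! i) (l ! j) \<and> \<not> R (l ! j) (l ! i)"
    and x: "\<And>i j. \<lbrakk>i < j; j < length l\<rbrakk> \<Longrightarrow> x (l ! j) \<le> x (l ! i)"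
  shows "(\<integral>t. payoff_among R f x {1..n} t \<partial>arrival_times n)
    = (\<Sum>j<n. measure unif {s. f s \<le> x (l ! j)} ^ Suc j
        * ((\<Sum>i<Suc j. x (l ! i)) / Suc j - (\<Sum>i<j. x (l ! i)) / j))"
proof -
  let ?M = "arrival_times n"
  let ?S = "\<lambda>j. set (take j l)"
  interpret prob_space ?M by (rule prob_space_arrival_times)
  have len: "length l = n" using l distinct_card[of l] by simp
  have S: "?S j \<subseteq> {1..n}" for j using l set_take_subset by metis
  have sub: "?S j \<subseteq> ?S (Suc j)" for j by (rule set_take_subset_set_take) simp
  have cardS: "card (?S j) = j" if "j \<le> n" for j
    using l len that by (simp add: distinct_card)
  let ?g = "\<lambda>j K t. of_bool (\<forall>i\<in>?S (Suc j). f (t i) \<le> x (l ! j)) * first_value x K t"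
  have meas: "?g j K \<in> borel_measurable ?M" if "K \<subseteq> {1..n}" for j K
    using pred_all_below[OF S f(2)] measurable_first_value[OF that] by measurable
  have bound: "\<bar>?g j K t\<bar> \<le> (\<Sum>k\<in>K. \<bar>x k\<bar>)" for j K t
  proof -
    have "\<bar>first_value x K t\<bar> \<le> (\<Sum>k\<in>K. \<bar>x k * of_bool (\<forall>j\<in>K - {k}. t k < t j)\<bar>)"
      unfolding first_value_def by (rule sum_abs)
    also have "\<dots> \<le> (\<Sum>k\<in>K. \<bar>x k\<bar>)" by (intro sum_mono) auto
    finally show ?thesis by (auto intro!: sum_nonneg)
  qed
  have int: "integrable ?M (?g j K)" if "K \<subseteq> {1..n}" for j K
    by (rule integrable_const_bound[where B = "\<Sum>k\<in>K. \<bar>x k\<bar>", OF _ meas[OF that]])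
      (simp only: real_norm_def bound AE_I2)
  have "(\<integral>t. payoff_among R f x {1..n} t \<partial>?M) = (\<integral>t. (\<Sum>j<n. ?g j (?S (Suc j)) t - ?g j (?S j) t) \<partial>?M)"
  proof (rule integral_cong_AE)
    show "payoff_among R f x {1..n} \<in> borel_measurable ?M"
      using f by (intro measurable_payoff_among) auto
    show "(\<lambda>t. \<Sum>j<n. ?g j (?S (Suc j)) t - ?g j (?S j) t) \<in> borel_measurable ?M"
      by (intro borel_measurable_sum borel_measurable_diff meas S)
    show "AE t in ?M. payoff_among R f x {1..n} t = (\<Sum>j<n. ?g j (?S (Suc j)) t - ?g j (?S j) t)"
      using AE_arrival_times_inj
    proof eventually_elim
      case (elim t)
      have "payoff_among R f x (?S n) t = (\<Sum>j<n. of_bool (\<forall>i\<in>?S (Suc j). f (t i) \<le> x (l ! j))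
        * (first_value x (?S (Suc j)) t - first_value x (?S j) t))"
        using l len elim by (intro payoff_among_telescope f R x) auto
      then show ?case using l len by (simp add: right_diff_distrib)
    qed
  qed
  also have "\<dots> = (\<Sum>j<n. (\<integral>t. ?g j (?S (Suc j)) t \<partial>?M) - (\<integral>t. ?g j (?S j) t \<partial>?M))"
    by (subst Bochner_Integration.integral_sum)
      (auto intro!: Bochner_Integration.integrable_diff int S sum.cong Bochner_Integration.integral_diff)
  also have "\<dots> = (\<Sum>j<n. measure unif {s. f s \<le> x (l ! j)} ^ Suc j
        * ((\<Sum>i<Suc j. x (l ! i)) / Suc j - (\<Sum>i<j. x (l ! i)) / j))"
  proof (intro sum.cong refl)
    fix j assume "j \<in> {..<n}"
    then have j: "Suc j \<le> n" "j \<le> n" by auto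
    show "(\<integral>t. ?g j (?S (Suc j)) t \<partial>?M) - (\<integral>t. ?g j (?S j) t \<partial>?M) = measure unif {s. f s \<le> x (l ! j)} ^ Suc j
        * ((\<Sum>i<Suc j. x (l ! i)) / Suc j - (\<Sum>i<j. x (l ! i)) / j)"
      using j len l(1)
      unfolding expectation_first_value[OF S order_refl f(2)] expectation_first_value[OF S sub f(2)]
      by (simp only: cardS sum_set_take_nth right_diff_distrib)
  qed
  finally show ?thesis .
qed

section \<open>Tie-breaking, the exponential threshold and the final assembly\<close>

lemma beats_iff: "beats \<eta> x i j \<longleftrightarrow> x j < x i \<or> x j = x i \<and> \<eta> j < \<eta> i"
proof -
  \<comment> \<open>A strict difference of the values survives small noise by this limit; at equal
    values they cancel and the positive factor \<open>\<epsilon>\<close> leaves the comparison of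
    \<open>\<eta>\<close>.\<close>
  have limit: "((\<lambda>\<epsilon>. (x i + \<epsilon> * \<eta> i) - (x j + \<epsilon> * \<eta> j)) \<longlongrightarrow> (x i + 0 * \<eta> i) - (x j + 0 * \<eta> j)) (at_right 0)"
    by (intro tendsto_intros)
  consider "x j < x i" | "x i < x j" | "x i = x j" by linarith
  then show ?thesis
  proof cases
    case 1
    then have "\<forall>\<^sub>F \<epsilon> in at_right 0. 0 < (x i + \<epsilon> * \<eta> i) - (x j + \<epsilon> * \<eta> j)"
      using order_tendstoD(1)[OF limit, of 0] by simp
    with 1 show ?thesis by (simp add: beats_def)
  next
    case 2
    then have "\<forall>\<^sub>F \<epsilon> in at_right 0. (x i + \<epsilon> * \<eta> i) - (x j + \<epsilon> * \<eta> j) < 0"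
      using order_tendstoD(2)[OF limit, of 0] by simp
    moreover have False if "\<forall>\<^sub>F \<epsilon> in at_right 0. x j + \<epsilon> * \<eta> j < x i + \<epsilon> * \<eta> i"
      and "\<forall>\<^sub>F \<epsilon> in at_right 0. (x i + \<epsilon> * \<eta> i) - (x j + \<epsilon> * \<eta> j) < 0"
    proof -
      from that have "\<forall>\<^sub>F \<epsilon> in at_right (0::real). False" by eventually_elim simp
      then show False by (simp add: trivial_limit_at_right_real)
    qed
    ultimately have "\<not> beats \<eta> x i j" unfolding beats_def by blast
    with 2 show ?thesis by simp
  next
    case 3
    have "\<forall>\<^sub>F \<epsilon> in at_right (0::real). (x j + \<epsilon> * \<eta> j < x i + \<epsilon> * \<eta> i) = (\<eta> j < \<eta> i)"
      using eventually_at_right_less[of "0::real"] by eventually_elim (simp add: 3)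
    then have "beats \<eta> x i j \<longleftrightarrow> (\<forall>\<^sub>F \<epsilon> in at_right (0::real). \<eta> j < \<eta> i)"
      unfolding beats_def by (rule eventually_subst)
    with 3 show ?thesis by (simp add: eventually_const_iff trivial_limit_at_right_real)
  qed
qed

text \<open>There are finitely many pairs, so one \<open>\<epsilon>\<close> realizes every relation
  of \<open>beats\<close>; sorting by the perturbed values then ranks the items. Injectivity of
  \<open>\<eta>\<close> makes the relation total on distinct items.\<close>

lemma exists_ranking:
  fixes \<eta> :: "nat \<Rightarrow> real"
  assumes "inj \<eta>"
  obtains l where "distinct l" "set l = {1..n}"
    "\<And>i j. \<lbrakk>i < j; j < length l\<rbrakk> \<Longrightarrow> beats \<eta> x (l ! i) (l ! j) \<and> \<not> beats \<eta> x (l ! j) (l ! i)"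
proof -
  have "\<forall>\<^sub>F \<epsilon> in at_right (0::real). \<forall>i\<in>{1..n}. \<forall>j\<in>{1..n}. beats \<eta> x i j \<longrightarrow> x j + \<epsilon> * \<eta> j < x i + \<epsilon> * \<eta> i"
    by (intro eventually_ball_finite ballI finite_atLeastAtMost) (auto simp: beats_def)
  from eventually_happens'[OF trivial_limit_at_right_real this] obtain \<epsilon> :: real
    where \<epsilon>: "\<And>i j. \<lbrakk>i \<in> {1..n}; j \<in> {1..n}; beats \<eta> x i j\<rbrakk> \<Longrightarrow> x j + \<epsilon> * \<eta> j < x i + \<epsilon> * \<eta> i"
    by blast
  \<comment> \<open>The minus sign makes the ascending sort start with the largest value.\<close>
  define key where "key = (\<lambda>i. - (x i + \<epsilon> * \<eta> i))"
  define l where "l = sort_key key [1..<Suc n]"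
  have l: "distinct l" "set l = {1..n}" by (auto simp: l_def)
  show ?thesis
  proof (rule that[OF l])
    fix i j assume ij: "i < j" "j < length l"
    have mem: "l ! i \<in> {1..n}" "l ! j \<in> {1..n}" using ij l(2) nth_mem[of _ l] by auto
    have "key (l ! i) \<le> key (l ! j)"
      using sorted_nth_mono[OF sorted_sort_key[of key "[1..<Suc n]"], of i j] ij by (simp add: l_def)
    then have "\<not> beats \<eta> x (l ! j) (l ! i)"
      using \<epsilon>[OF mem(2,1)] by (auto simp: key_def)
    moreover have "l ! i \<noteq> l ! j" using ij l(1) by (simp add: nth_eq_iff_index_eq)
    then have "\<eta> (l ! i) \<noteq> \<eta> (l ! j)" using assms by (simp add: inj_eq)
    ultimately show "beats \<eta> x (l ! i) (l ! j) \<and> \<not> beats \<eta> x (l ! j) (l ! i)"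
      by (auto simp: beats_iff)
  qed
qed

text \<open>The threshold is met exactly from time \<open>s0 = - c * ln y\<close> on.
  \<open>y \<le> 1\<close> gives \<open>0 \<le> s0\<close>, and for \<open>s0 > 1\<close> no
  admissible time is left, whence the maximum with \<open>0\<close>.\<close>

lemma measure_below_threshold:
  assumes "y \<le> 1"
  shows "measure unif {s. exp (- s / 0.472) \<le> y} = acceptance_prob y"
proof (cases "y \<le> 0")
  case True
  then have "{s. exp (- s / 0.472) \<le> y} = {}"
    using less_le_trans[OF exp_gt_zero] by (auto simp: not_le[symmetric])
  with True show ?thesis by (simp add: acceptance_prob_def)
next
  case False
  define s0 where "s0 = - (472/1000) * ln y"
  have s0: "0 \<le> s0" using False assms by (simp add: s0_def)
  have iff: "exp (- s / 0.472) \<le> y \<longleftrightarrow> s0 \<le> s" for s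
  proof -
    have "exp (- s / 0.472) \<le> y \<longleftrightarrow> - s / 0.472 \<le> ln y"
      using False by (metis exp_le_cancel_iff exp_ln not_le)
    also have "\<dots> \<longleftrightarrow> - s \<le> ln y * 0.472" by (rule pos_divide_le_eq) simp
    also have "\<dots> \<longleftrightarrow> s0 \<le> s" by (auto simp: s0_def)
    finally show ?thesis .
  qed
  have "measure unif {s. s0 \<le> s} = measure lborel ({0..1} \<inter> {s. s0 \<le> s}) / measure lborel {0..1::real}"
    by (rule measure_uniform_measure) auto
  also have "{0..1} \<inter> {s. s0 \<le> s} = {s0..1}" using s0 by auto
  finally have "measure unif {s. exp (- s / 0.472) \<le> y} = max 0 (1 - s0)"
    unfolding iff by (simp add: max_def)
  then show ?thesis using False by (simp add: acceptance_prob_def s0_def)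
qed

lemma best_only_pricing_curve_regret_le:
  assumes "inj \<eta>" and "(n, x) \<in> instances"
  shows "x 1 - (\<integral>t. payoff x (best_only_pricing_curve \<eta> (\<lambda>t. exp (- t / 0.472)) n x t) \<partial>arrival_times n) \<le> 19/100"
proof -
  let ?f = "\<lambda>t::real. exp (- t / 0.472)"
  have n: "1 \<le> n" and x: "\<And>i. i \<in> {1..n} \<Longrightarrow> 0 \<le> x i \<and> x i \<le> 1"
    and dec: "\<And>i j. \<lbrakk>i \<in> {1..n}; j \<in> {1..n}; i \<le> j\<rbrakk> \<Longrightarrow> x j \<le> x i"
    using assms(2) by (auto simp: instances_def)
  obtain l where l: "distinct l" "set l = {1..n}"
    and R: "\<And>i j. \<lbrakk>i < j; j < length l\<rbrakk> \<Longrightarrow> beats \<eta> x (l ! i) (l ! j) \<and> \<not> beats \<eta> x (l ! j) (l ! i)"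
    using exists_ranking[OF assms(1)] by metis
  have len: "length l = n" using l distinct_card[of l] by simp
  have mono: "x (l ! j) \<le> x (l ! i)" if "i < j" "j < length l" for i j
    using R[OF that] by (auto simp: beats_iff)
  have mem: "l ! i \<in> {1..n}" if "i < n" for i using that l(2) len nth_mem[of i l] by auto
  \<comment> \<open>Ranks count from \<open>1\<close>, positions in \<open>l\<close> from
    \<open>0\<close>. \<open>A 0\<close> is \<open>0 / 0 = 0\<close>, so the increment at rank 1 is
    \<open>y 1\<close>.\<close>
  define y where "y = (\<lambda>j. x (l ! (j - 1)))"
  define A where "A = (\<lambda>j. (\<Sum>i<j. x (l ! i)) / real j)"
  \<comment> \<open>Under ties the top-ranked item need not be item \<open>1\<close>, but it has the
    same value.\<close>
  have y1: "y 1 = x 1"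
  proof -
    have "1 \<in> set l" using l n by auto
    then obtain k where k: "k < n" "l ! k = 1" using len by (auto simp: in_set_conv_nth)
    have "x (l ! k) \<le> x (l ! 0)" using mono[of 0 k] k len by (cases "k = 0") auto
    moreover have "x (l ! 0) \<le> x 1" using dec[of 1 "l ! 0"] mem[of 0] n by auto
    ultimately show ?thesis using k by (simp add: y_def)
  qed
  have "antimono ?f" by (auto intro!: antimonoI)
  then have "(\<integral>t. payoff_among (beats \<eta> x) ?f x {1..n} t \<partial>arrival_times n)
    = (\<Sum>j<n. measure unif {s. ?f s \<le> x (l ! j)} ^ Suc j * (A (Suc j) - A j))"
    unfolding A_def by (intro expectation_payoff_among l R mono) auto
  also have "\<dots> = (\<Sum>j<n. acceptance_prob (y (Suc j)) ^ Suc j * (A (Suc j) - A j))"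
  proof (intro sum.cong refl)
    fix j assume "j \<in> {..<n}"
    then have "measure unif {s. ?f s \<le> x (l ! j)} = acceptance_prob (y (Suc j))"
      using measure_below_threshold[of "x (l ! j)"] x mem[of j] by (simp only: y_def diff_Suc_1 lessThan_iff)
    then show "measure unif {s. ?f s \<le> x (l ! j)} ^ Suc j * (A (Suc j) - A j)
        = acceptance_prob (y (Suc j)) ^ Suc j * (A (Suc j) - A j)" by (rule arg_cong)
  qed
  also have "\<dots> = (\<Sum>j=1..n. acceptance_prob (y j) ^ j * (A j - A (j - 1)))"
    by (rule sum.reindex_bij_witness[of _ "\<lambda>j. j - 1" Suc]) auto
  also have "\<dots> = acceptance_prob (y 1) * y 1 + (\<Sum>j=2..n. acceptance_prob (y j) ^ j * (A j - A (j - 1)))"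
    using n by (simp add: sum.atLeast_Suc_atMost A_def y_def numeral_2_eq_2)
  also have "(\<Sum>j=2..n. acceptance_prob (y j) ^ j * (A j - A (j - 1)))
      = - (\<Sum>j=2..n. acceptance_prob (y j) ^ j * (A (j - 1) - A j))"
    unfolding sum_negf[symmetric] by (intro sum.cong) (auto simp: algebra_simps)
  finally have E: "(\<integral>t. payoff_among (beats \<eta> x) ?f x {1..n} t \<partial>arrival_times n)
     = acceptance_prob (y 1) * y 1 - (\<Sum>j=2..n. acceptance_prob (y j) ^ j * (A (j - 1) - A j))" by simp
  have "y 1 * (1 - acceptance_prob (y 1)) + (\<Sum>j=2..n. acceptance_prob (y j) ^ j * (A (j - 1) - A j)) \<le> 19/100"
  proof (rule regret_value_le[OF n])
    show "0 \<le> y i \<and> y i \<le> 1" if "1 \<le> i" "i \<le> n" for i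
      using x mem[of "i - 1"] that by (simp add: y_def)
    show "y (Suc i) \<le> y i" if "1 \<le> i" "i < n" for i
      using mono[of "i - 1" i] that len by (simp add: y_def)
    show "A 1 = y 1" by (simp add: A_def y_def)
    show "A j = A (j - 1) - (A (j - 1) - y j) / j" if j: "2 \<le> j" "j \<le> n" for j
    proof -
      obtain m where m: "j = Suc m" "1 \<le> m" using j by (cases j) auto
      have "(u * a + v) / (a + 1) = u - (u - v) / (a + 1)" if "0 < a" for u v a :: real
        using that by (simp add: field_simps)
      from this[of "real m" "A m" "x (l ! m)"] m show ?thesis by (simp add: A_def y_def add.commute)
    qed
  qed
  then have "x 1 - (\<integral>t. payoff_among (beats \<eta> x) ?f x {1..n} t \<partial>arrival_times n) \<le> 19/100"
    unfolding E y1[symmetric] by (simp add: algebra_simps)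
  moreover have "payoff x (best_only_pricing_curve \<eta> ?f n x t) = payoff_among (beats \<eta> x) ?f x {1..n} t" for t
    unfolding payoff_among_def best_only_pricing_curve_def acceptable_def accepted_among_def by (rule refl)
  ultimately show ?thesis by (simp only:)
qed

theorem theorem4p2:
  fixes \<eta> :: "nat \<Rightarrow> real"
  assumes "inj \<eta>"
  shows "regret (best_only_pricing_curve \<eta> (\<lambda>t. exp (- t / 0.472))) \<le> ereal 0.190"
proof -
  have "ereal (x 1 - (\<integral>t. payoff x (best_only_pricing_curve \<eta> (\<lambda>t. exp (- t / 0.472)) n x t) \<partial>arrival_times n)) \<le> ereal 0.190"
    if "(n, x) \<in> instances" for n x
    using order_trans[OF best_only_pricing_curve_regret_le[OF assms that], of "0.190"] by simp
  then show ?thesis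
    unfolding regret_def by (intro SUP_least) (simp only: case_prod_unfold prod.collapse)
qed

end
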